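(* Let $p>5$ be a prime. If $p\equiv 1\pmod 3$ and $x,y$ are integers with $p=x^2+3y^2$ (such integers exist), then $$\sum_{k=0}^{p-1}\binom{2k}{k}\frac{f_k}{50^k}\equiv 4x^2\pmod p.$$ If $p\equiv 2\pmod 3$, then $$\sum_{k=0}^{p-1}\binom{2k}{k}\frac{f_k}{50^k}\equiv 0\pmod p.$$
   Context: The Franel numbers are $f_n=\sum_{k=0}^n\binom{n}{k}^3$ for $n=0,1,2,\ldots$. Congruences modulo $p$ are taken in the ring of rational numbers whose denominator is not divisible by $p$. *)

theory Defs
  imports Complex_Main "HOL-Number_Theory.Number_Theory"
begin

definition franel :: "nat \<Rightarrow> nat" where
  "franel n = (\<Sum>k\<le>n. (n choose k) ^ 3)"

text \<open>The second component of \<^const>\<open>quotient_of\<close> is the positive denominator in lowest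
  terms. For prime \<open>p\<close> this set is the localization of the integers at \<open>p\<close>.\<close>

definition p_integral :: "nat \<Rightarrow> rat set" where
  "p_integral p = {q. \<not> int p dvd snd (quotient_of q)}"

text \<open>Congruence modulo the principal ideal generated by \<open>p\<close> in the ring \<open>p_integral p\<close>; both
  sides are required to lie in that ring.\<close>

definition p_cong :: "nat \<Rightarrow> rat \<Rightarrow> rat \<Rightarrow> bool" where
  "p_cong p a b \<longleftrightarrow>
     a \<in> p_integral p \<and> b \<in> p_integral p \<and> (\<exists>r\<in>p_integral p. a - b = of_nat p * r)"

end

theory Submission
  imports Defs "HOL-Computational_Algebra.Computational_Algebra"
begin

text \<open>
  Write \<open>U k = (2k choose k) f k\<close> for \<open>central_franel\<close> and \<open>c k = (3k)! / k!^3\<close> for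
  \<open>multinom3\<close>. The sum over \<open>U k / 50^k\<close> is evaluated
  modulo \<open>p\<close> because the series of \<open>U\<close> is, up to an algebraic change of variable, the square of a
  hypergeometric series, and at the argument \<open>1/50\<close> that hypergeometric series sits at the
  point \<open>1/54\<close>, where it has complex multiplication and a closed form.

  \<^bold>\<open>Two transformations.\<close> Let \<open>F(z)\<close> be the generating function of the Franel numbers. It
  satisfies a linear differential equation of order two, so its square satisfies one of order three.
  With \<open>a = 1 - 7z - 8z^2\<close> and \<open>e = 1 + 8z^2\<close>, comparison of differential equations gives a
  formula of Clausen type and a cubic transformation,
  \<open>F(z)^2 = (1/e) \<Sum> U k (z a / e^2)^k\<close> and
  \<open>F(z) = (1/(1 - 2z)) \<Sum> c k (z^2 / (1 - 2z)^3)^k\<close>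
  (lemmas \<open>franel_clausen\<close> and \<open>franel_cubic_transformation\<close>). All coefficients are integers.

  \<^bold>\<open>Reduction modulo p.\<close> Since \<open>p\<close> divides \<open>U k\<close> for \<open>p/2 < k < p\<close> and \<open>c k\<close> for
  \<open>p/3 < k < p\<close>, and since \<open>e^p\<close> and \<open>(1 - 2z)^p\<close> are \<open>1\<close> modulo \<open>p\<close> and \<open>z^p\<close>, both right-hand
  sides agree with explicit polynomials modulo \<open>p\<close> and \<open>z^p\<close>. So the polynomial made from the \<open>U k\<close>
  and the square of the one made from the \<open>c k\<close> have the same first \<open>p\<close> coefficients modulo \<open>p\<close>.
  Both have degree at most \<open>2(p - 1)\<close> and are self-reciprocal modulo \<open>p\<close> under
  \<open>z \<mapsto> -1/(8z)\<close>, hence they agree entirely (\<open>clausen_poly_cong_cubic_poly_squared\<close>).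

  \<^bold>\<open>Specialization.\<close> At \<open>z = (3 sqrt 3 - 5)/2\<close> one has \<open>z a / e^2 = 1/50\<close> and
  \<open>z^2/(1 - 2z)^3 = 1/54\<close>, and the remaining factors are powers of units and of integers to which
  Fermat's theorem applies. Thus \<open>\<Sum> U k / 50^k\<close> is congruent to the square of \<open>\<Sum> c k / 54^k\<close>
  (\<open>central_franel_sum_cong_square\<close>).

  \<^bold>\<open>The remaining sum.\<close> With \<open>m = p div 3\<close>, \<open>c k\<close> is congruent to
  \<open>(-27)^k (m choose k) (m + k choose k)\<close>, so \<open>\<Sum> c k / 54^k\<close> is the value at \<open>0\<close> of the Legendre
  polynomial of degree \<open>m\<close>. If \<open>p\<close> is \<open>2\<close> modulo \<open>3\<close> then \<open>m\<close> is odd and the value is \<open>0\<close>. If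
  \<open>p = 6n + 1\<close>, it is \<open>((p - 1)/2 choose n)\<close> modulo \<open>p\<close>, which is minus the character sum \<open>T\<close> of
  \<open>x^3 + 1\<close>. The first and second moments of the sums belonging to \<open>x^3 + a\<close> show that
  \<open>p = (T/2)^2 + 3 B^2\<close>; as such a representation determines \<open>(T/2)^2\<close>, the sum is \<open>4 x^2\<close>.
\<close>

section \<open>The recurrence of the Franel numbers\<close>

text \<open>
  Creative telescoping: with a suitable cubic polynomial \<open>R\<close> in \<open>k\<close>, the recurrence applied to the
  summand \<open>(n choose k)^3\<close> is, up to a factor free of \<open>k\<close>, the difference
  \<open>g (k + 1) - g k\<close> with \<open>g k = R k (k (n + 2 choose k))^3\<close>, and \<open>g\<close> vanishes at both ends.
\<close>
lemma franel_recurrence: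
  "(int n + 2)\<^sup>2 * int (franel (n + 2)) =
     (7 * (int n)\<^sup>2 + 21 * int n + 16) * int (franel (n + 1)) + 8 * (int n + 1)\<^sup>2 * int (franel n)"
proof -
  define N where "N = int n"
  define B0 where "B0 k = int (n choose k)" for k
  define B1 where "B1 k = int (Suc n choose k)" for k
  define M where "M k = int (Suc (Suc n) choose k)" for k
  \<comment> \<open>The certificate; its coefficients solve the linear system obtained by comparing powers of \<open>k\<close>.\<close>
  define R where "R x = 4 * x ^ 3 - (30 + 18 * N) * x\<^sup>2 + (78 + 93 * N + 27 * N\<^sup>2) * x
      - (72 + 128 * N + 74 * N\<^sup>2 + 14 * N ^ 3)" for x :: int
  define g where "g k = R (int k) * (int k * M k) ^ 3" for k
  define T where "T k = (N + 2)\<^sup>2 * M k ^ 3 - (7 * N\<^sup>2 + 21 * N + 16) * B1 k ^ 3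
      - 8 * (N + 1)\<^sup>2 * B0 k ^ 3" for k
  have absorb: "int (Suc j) * int (j choose k) = (int (Suc j) - int k) * int (Suc j choose k)" for j k
  proof (cases "k \<le> Suc j")
    case True
    have "Suc j * (j choose k) = (Suc j - k) * (Suc j choose k)"
      using binomial_absorb_comp[of "Suc j" k] by simp
    thus ?thesis using True by (metis of_nat_diff of_nat_mult)
  qed (auto simp: binomial_eq_0)
  have step: "int (Suc k) * M (Suc k) = (N + 2 - int k) * M k" for k
  proof -
    have "int (Suc k) * M (Suc k) = int (Suc (Suc n)) * int (Suc n choose k)"
      unfolding M_def by (metis Suc_times_binomial_eq mult.commute of_nat_mult)
    thus ?thesis using absorb[of "Suc n" k] by (simp add: M_def N_def)
  qed
  have T: "(N + 1) * (N + 2) ^ 3 * T k = g (Suc k) - g k" for k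
  proof -
    have b1: "(N + 2) * B1 k = (N + 2 - int k) * M k"
      using absorb[of "Suc n" k] by (simp add: B1_def M_def N_def add.commute)
    have b0: "(N + 1) * B0 k = (N + 1 - int k) * B1 k"
      using absorb[of n k] by (simp add: B1_def B0_def N_def add.commute)
    have b02: "(N + 1) * ((N + 2) * B0 k) = (N + 1 - int k) * ((N + 2 - int k) * M k)"
      unfolding b1[symmetric] using b0 by (metis mult.left_commute)
    have "(N + 1)\<^sup>2 * ((N + 1) * (N + 2) ^ 3 * T k)
        = (N + 1) ^ 3 * (N + 2) ^ 5 * M k ^ 3
          - (7 * N\<^sup>2 + 21 * N + 16) * (N + 1) ^ 3 * ((N + 2) * B1 k) ^ 3
          - 8 * (N + 1)\<^sup>2 * ((N + 1) * ((N + 2) * B0 k)) ^ 3"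
      unfolding T_def by (simp add: power_numeral_reduce algebra_simps)
    also have "\<dots> = (N + 1)\<^sup>2 * (R (int k + 1) * ((N + 2 - int k) * M k) ^ 3 - R (int k) * (int k * M k) ^ 3)"
      unfolding b1 b02 R_def by (simp add: power_numeral_reduce algebra_simps)
    also have "\<dots> = (N + 1)\<^sup>2 * (g (Suc k) - g k)"
      unfolding g_def step by (simp add: add.commute)
    finally show ?thesis by (simp add: N_def)
  qed
  have "(N + 1) * (N + 2) ^ 3 * (\<Sum>k<n + 3. T k) = g (n + 3) - g 0"
    by (simp only: sum_distrib_left T sum_lessThan_telescope)
  also have "\<dots> = 0" by (simp add: g_def M_def binomial_eq_0)
  finally have "(\<Sum>k<n + 3. T k) = 0" by (simp add: N_def)
  moreover have ext: "(\<Sum>k<n + 3. int (j choose k) ^ 3) = int (franel j)" if "j \<le> n + 2" for j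
  proof -
    have "int (franel j) = (\<Sum>k\<le>j. int (j choose k) ^ 3)" by (simp add: franel_def)
    also have "\<dots> = (\<Sum>k<n + 3. int (j choose k) ^ 3)"
      by (rule sum.mono_neutral_left) (use that in auto)
    finally show ?thesis by simp
  qed
  ultimately show ?thesis
    using ext[of n] ext[of "Suc n"] ext[of "Suc (Suc n)"]
    by (simp add: T_def sum_subtractf sum_distrib_left[symmetric] M_def B1_def B0_def N_def add.commute)
qed

section \<open>A derivation on integer power series\<close>

abbreviation X :: "int fps" where "X \<equiv> fps_X"

text \<open>
  The Euler operator acts diagonally on coefficients, which turns recurrences into differential
  equations. Coefficients are kept in \<open>\<int>\<close> so that identities can later be read modulo \<open>p\<close>.
\<close>
definition theta :: "int fps \<Rightarrow> int fps" where
  "theta f = X * fps_deriv f"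

lemma theta_nth [simp]: "theta f $ n = of_nat n * f $ n"
  by (cases n) (auto simp: theta_def)

text \<open>
  The differential equation of the Franel generating function is \<open>a \<theta> (a \<theta> F) = a b F\<close>; the
  zeros of \<open>a = (1 - 8z)(1 + z)\<close> are its finite nonzero singularities. This form suggests the
  derivation \<open>\<delta> = a \<theta>\<close>, for which no first-order term occurs.
\<close>
definition fa :: "int fps" where "fa = 1 - 7 * X - 8 * X\<^sup>2"
definition fb :: "int fps" where "fb = 2 * X + 8 * X\<^sup>2"

definition delta :: "int fps \<Rightarrow> int fps" where
  "delta f = fa * theta f"

lemma theta_simps:
  "theta (f + g) = theta f + theta g" "theta (f - g) = theta f - theta g"
  "theta (f * g) = theta f * g + f * theta g" "theta X = X"
  "theta (numeral k) = 0" "theta 1 = 0" "theta (- f) = - theta f"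
  by (simp_all add: theta_def algebra_simps)

lemma theta_power: "theta (f ^ k) = of_nat k * f ^ (k - 1) * theta f"
  by (simp add: theta_def fps_deriv_power' algebra_simps)

lemma delta_simps:
  "delta (f + g) = delta f + delta g" "delta (f - g) = delta f - delta g"
  "delta (f * g) = delta f * g + f * delta g" "delta X = fa * X"
  "delta (numeral k) = 0" "delta 1 = 0" "delta (- f) = - delta f"
  by (simp_all add: delta_def theta_simps algebra_simps)

lemma delta_power: "delta (f ^ k) = of_nat k * f ^ (k - 1) * delta f"
  by (simp add: delta_def theta_power algebra_simps)

lemma fps_mult_nth_vanish:
  fixes f g :: "int fps"
  assumes "\<And>i. i < n \<Longrightarrow> g $ i = 0"
  shows "(f * g) $ n = f $ 0 * g $ n" and "i < n \<Longrightarrow> (f * g) $ i = 0"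
proof -
  have "(f * g) $ n = (\<Sum>i\<in>{0}. f $ i * g $ (n - i))"
    unfolding fps_mult_nth by (rule sum.mono_neutral_right) (auto simp: assms)
  thus "(f * g) $ n = f $ 0 * g $ n" by simp
  show "i < n \<Longrightarrow> (f * g) $ i = 0" using assms by (auto simp: fps_mult_nth)
qed

lemma delta_vanish:
  assumes "\<And>i. i < n \<Longrightarrow> g $ i = 0"
  shows "delta g $ n = of_nat n * g $ n" and "i < n \<Longrightarrow> delta g $ i = 0"
  using fps_mult_nth_vanish[where n = n and g = "theta g" and f = fa] assms
  by (simp_all add: delta_def fa_def)

text \<open>
  If \<open>w z^n\<close> with \<open>n > 0\<close> were the lowest term of \<open>W\<close>, the left-hand side would have lowest term
  \<open>n^3 w z^n\<close>, whereas the right-hand side starts later because \<open>c\<close> and \<open>d\<close> have no constant term.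
\<close>
lemma delta3_unique:
  fixes W c d :: "int fps"
  assumes ode: "delta (delta (delta W)) = c * delta W + d * W"
    and "c $ 0 = 0" "d $ 0 = 0" "W $ 0 = 0"
  shows "W = 0"
proof -
  have "W $ n = 0" for n
  proof (induction n rule: less_induct)
    case (less n)
    note D = delta_vanish[of n]
    have "delta (delta (delta W)) $ n = int n * (int n * (int n * W $ n))"
      using less D[of W] D[of "delta W"] D[of "delta (delta W)"] by simp
    moreover have "(c * delta W + d * W) $ n = 0"
      using less D[of W] fps_mult_nth_vanish(1)[where n = n and g = "delta W" and f = c]
        fps_mult_nth_vanish(1)[where n = n and g = W and f = d] assms
      by simp
    ultimately show ?case using ode assms(4) by (cases "n = 0") auto
  qed
  thus ?thesis by (simp add: fps_eq_iff)
qed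

lemma delta2_unique:
  fixes W d :: "int fps"
  assumes ode: "delta (delta W) = d * W" and "d $ 0 = 0" "W $ 0 = 0"
  shows "W = 0"
proof (rule delta3_unique[of W d "delta d"])
  show "delta (delta (delta W)) = d * delta W + delta d * W"
    unfolding ode by (simp add: delta_simps algebra_simps)
qed (use assms in \<open>simp_all add: delta_def\<close>)

definition franel_fps :: "int fps" where "franel_fps = Abs_fps (\<lambda>n. int (franel n))"

lemma franel_0 [simp]: "franel 0 = 1" and franel_1 [simp]: "franel (Suc 0) = 2"
  by (simp_all add: franel_def atMost_Suc)

lemma delta2_expand:
  "delta (delta f) = fa * (fa * theta (theta f) - (7 * X + 16 * X\<^sup>2) * theta f)"
  by (simp add: delta_def theta_simps fa_def power2_eq_square algebra_simps)

lemma fps_X_mult_numeral_nth: "(X * f) $ n = (if n = 0 then 0 else f $ (n - 1))"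
  "(numeral k * f) $ n = numeral k * (f $ n :: int)" "(f * numeral k) $ n = (f $ n :: int) * numeral k"
  by (auto simp: numeral_fps_const)

lemma delta2_franel_fps: "delta (delta franel_fps) = fa * fb * franel_fps"
proof -
  have "(fa * theta (theta franel_fps) - (7 * X + 16 * X\<^sup>2) * theta franel_fps - fb * franel_fps) $ n = 0" for n
  proof -
    consider "n = 0" | "n = 1" | m where "n = m + 2"
      by (metis One_nat_def add_2_eq_Suc' not0_implies_Suc)
    thus ?thesis
    proof cases
      case 3
      thus ?thesis using franel_recurrence[of m]
        by (simp add: fa_def fb_def franel_fps_def power2_eq_square algebra_simps fps_X_mult_numeral_nth)
    qed (simp_all add: fa_def fb_def franel_fps_def power2_eq_square algebra_simps fps_X_mult_numeral_nth)
  qed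
  hence "fa * theta (theta franel_fps) - (7 * X + 16 * X\<^sup>2) * theta franel_fps = fb * franel_fps"
    by (simp add: fps_eq_iff)
  thus ?thesis by (simp add: delta2_expand mult.assoc)
qed

text \<open>
  The symmetric square of an equation of order two.
\<close>
lemma delta3_square:
  assumes "delta (delta f) = q * f"
  shows "delta (delta (delta (f * f))) = 4 * q * delta (f * f) + 2 * delta q * (f * f)"
proof -
  have "delta (delta (f * f)) = 2 * (delta f * delta f) + 2 * q * (f * f)"
    by (simp add: delta_simps assms algebra_simps)
  hence "delta (delta (delta (f * f))) = delta (2 * (delta f * delta f) + 2 * q * (f * f))"
    by simp
  also have "\<dots> = 4 * q * delta (f * f) + 2 * delta q * (f * f)"
    by (simp add: delta_simps assms algebra_simps)
  finally show ?thesis .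
qed

text \<open>
  Chain rule. The factor \<open>r\<close> is the logarithmic derivative of \<open>\<phi>\<close> with respect to \<open>\<delta>\<close>; stating it
  multiplicatively avoids any division by \<open>\<phi>\<close>.
\<close>
lemma delta_compose:
  assumes "phi $ 0 = 0" "delta phi = phi * r"
  shows "delta (g oo phi) = r * (theta g oo phi)"
proof -
  have "delta (g oo phi) = (fps_deriv g oo phi) * (fa * (X * fps_deriv phi))"
    using assms by (simp add: delta_def theta_def fps_compose_deriv algebra_simps)
  also have "\<dots> = (fps_deriv g oo phi) * (phi * r)"
    using assms by (simp add: delta_def theta_def)
  also have "\<dots> = r * (theta g oo phi)"
    using assms(1) by (simp add: theta_def fps_compose_mult_distrib algebra_simps)
  finally show ?thesis .
qed

section \<open>A Clausen formula for the Franel numbers\<close>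

definition fe :: "int fps" where "fe = 1 + 8 * X\<^sup>2"

text \<open>
  The inverse of \<open>e\<close> has integer coefficients because the constant coefficient is a unit; the
  argument \<open>1\<close> is the inverse of that coefficient.
\<close>
definition fe_inv :: "int fps" where "fe_inv = fps_left_inverse fe 1"

text \<open>
  \<open>s / e\<close> is the logarithmic derivative (for \<open>\<delta>\<close>) of the Clausen argument \<open>z a / e^2\<close>, and
  \<open>s^2 / e^4\<close> is the leading coefficient of the third-order equation pulled back along it.
\<close>
definition fs :: "int fps" where "fs = 1 - 14 * X - 48 * X\<^sup>2 + 112 * X ^ 3 + 64 * X ^ 4"

text \<open>
  The numerator in \<open>\<delta> (1/e) = A / e^2\<close>.
\<close>
definition fA :: "int fps" where "fA = - (16 * fa * X\<^sup>2)"
definition clausen_arg :: "int fps" where "clausen_arg = fe_inv\<^sup>2 * (X * fa)"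

lemma fe_inv_fe: "fe_inv * fe = 1"
  unfolding fe_inv_def by (rule fps_left_inverse) (simp add: fe_def)

lemma delta_fe: "delta fe = - fA"
  by (simp add: fe_def fA_def delta_simps delta_power power2_eq_square algebra_simps)

lemma delta_fe_inv: "delta fe_inv = fe_inv\<^sup>2 * fA"
proof -
  have "delta (fe_inv * fe) = 0" by (simp add: fe_inv_fe delta_simps)
  hence "delta fe_inv * fe = fe_inv * fA" by (simp add: delta_simps delta_fe)
  hence "fe_inv * fe * delta fe_inv = fe_inv * fe_inv * fA" by (simp add: algebra_simps)
  thus ?thesis by (simp add: fe_inv_fe power2_eq_square)
qed

lemma delta_clausen_arg: "delta clausen_arg = clausen_arg * (fe_inv * fs)"
proof -
  have s: "fs * (X * fa) = fe * delta (X * fa) + 2 * fA * (X * fa)"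
    by (simp add: fs_def fe_def fA_def fa_def delta_simps delta_power power_numeral_reduce algebra_simps)
  have "delta clausen_arg = 2 * fe_inv ^ 3 * fA * (X * fa) + fe_inv\<^sup>2 * delta (X * fa)"
    by (simp add: clausen_arg_def delta_simps delta_power delta_fe_inv power_numeral_reduce algebra_simps del: delta_simps(4))
  also have "fe_inv\<^sup>2 * delta (X * fa) = fe_inv ^ 3 * (fe * delta (X * fa))"
    using fe_inv_fe by (simp add: power_numeral_reduce algebra_simps)
  also have "2 * fe_inv ^ 3 * fA * (X * fa) + fe_inv ^ 3 * (fe * delta (X * fa)) = fe_inv ^ 3 * (fs * (X * fa))"
    unfolding s by (simp add: algebra_simps)
  finally show ?thesis by (simp add: clausen_arg_def power_numeral_reduce algebra_simps)
qed

text \<open>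
  The following four polynomial identities compare coefficients, with denominators \<open>e\<close> cleared, when
  the third-order equation of the squared Franel series is tested on the pulled-back series: the leading
  coefficient, and then the coefficients of the second, first and zeroth derivative.
\<close>
lemma clausen_identity_c: "fe ^ 4 - 28 * (X * fa) * fe\<^sup>2 - 128 * (X * fa)\<^sup>2 = fs\<^sup>2"
  by (simp add: fs_def fe_def fa_def power_numeral_reduce algebra_simps)

lemma clausen_identity_2: "X * fa * (42 * fe\<^sup>2 + 384 * (X * fa)) + 6 * fA * fs + 3 * fe * delta fs = 0"
  by (simp add: fs_def fe_def fA_def fa_def delta_simps delta_power power_numeral_reduce algebra_simps)

lemma clausen_identity_1: "11 * fA\<^sup>2 * fs + 4 * fe * fs * delta fA + 5 * fe * fA * delta fs + fe\<^sup>2 * delta (delta fs)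
    + fs * (X * fa) * (22 * fe\<^sup>2 + 352 * (X * fa)) = 4 * (fa * fb) * fe\<^sup>2 * fs"
  by (simp add: fs_def fe_def fA_def fa_def fb_def delta_simps delta_power power_numeral_reduce algebra_simps)

lemma clausen_identity_0: "6 * fA ^ 3 + 6 * fe * fA * delta fA + fe\<^sup>2 * delta (delta fA)
    + fs * (X * fa) * (4 * fe\<^sup>2 + 96 * (X * fa)) = 4 * (fa * fb) * fe\<^sup>2 * fA + 2 * delta (fa * fb) * fe ^ 3"
  by (simp add: fs_def fe_def fA_def fa_def fb_def delta_simps delta_power power_numeral_reduce algebra_simps)

definition central_franel :: "nat \<Rightarrow> int" where "central_franel k = int ((2 * k choose k) * franel k)"
lemma central_franel_0 [simp]: "central_franel 0 = 1" and central_franel_1 [simp]: "central_franel (Suc 0) = 4"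
  by (simp_all add: central_franel_def)

definition central_franel_fps :: "int fps" where "central_franel_fps = Abs_fps central_franel"

lemma central_binomial_Suc:
  "(k + 1) * (2 * (k + 1) choose (k + 1)) = 2 * (2 * k + 1) * (2 * k choose k)"
proof -
  have "(k + 1) * (2 * (k + 1) choose (k + 1)) = 2 * ((k + 1) * (2 * k + 1 choose k))"
    using Suc_times_binomial_eq[of "2 * k + 1" k] by (simp add: algebra_simps del: binomial_Suc_Suc)
  also have "(k + 1) * (2 * k + 1 choose k) = (2 * k + 1) * (2 * k choose k)"
    using binomial_absorb_comp[of "2 * k + 1" k] by (simp add: algebra_simps del: binomial_Suc_Suc)
  finally show ?thesis by simp
qed

lemma central_franel_recurrence:
  "(int n + 2) ^ 3 * central_franel (n + 2) = 2 * (2 * int n + 3) * (7 * (int n)\<^sup>2 + 21 * int n + 16) * central_franel (n + 1)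
     + 32 * (int n + 1) * (2 * int n + 3) * (2 * int n + 1) * central_franel n"
proof -
  define N where "N = int n"
  define b where "b k = int (2 * k choose k)" for k
  define f where "f k = int (franel k)" for k
  have b: "(int k + 1) * b (k + 1) = 2 * (2 * int k + 1) * b k" for k
    using arg_cong[OF central_binomial_Suc[of k], of int] unfolding b_def
    by (simp only: of_nat_mult of_nat_add of_nat_1 of_nat_numeral)
  have b1: "(N + 1) * b (n + 1) = 2 * (2 * N + 1) * b n" using b[of n] by (simp add: N_def)
  have b2: "(N + 2) * b (n + 2) = 2 * (2 * N + 3) * b (n + 1)" using b[of "n + 1"] by (simp add: N_def algebra_simps)
  have f: "(N + 2)\<^sup>2 * f (n + 2) = (7 * N\<^sup>2 + 21 * N + 16) * f (n + 1) + 8 * (N + 1)\<^sup>2 * f n"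
    using franel_recurrence[of n] by (simp add: f_def N_def)
  have "(N + 2) ^ 3 * central_franel (n + 2) = ((N + 2) * b (n + 2)) * ((N + 2)\<^sup>2 * f (n + 2))"
    by (simp add: central_franel_def b_def f_def power_numeral_reduce)
  also have "\<dots> = 2 * (2 * N + 3) * (7 * N\<^sup>2 + 21 * N + 16) * (b (n + 1) * f (n + 1))
      + 16 * (2 * N + 3) * (N + 1) * ((N + 1) * b (n + 1)) * f n"
    unfolding b2 f by (simp add: power_numeral_reduce algebra_simps)
  also have "\<dots> = 2 * (2 * N + 3) * (7 * N\<^sup>2 + 21 * N + 16) * central_franel (n + 1)
      + 32 * (N + 1) * (2 * N + 3) * (2 * N + 1) * central_franel n"
    unfolding b1 by (simp add: central_franel_def b_def f_def algebra_simps)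
  finally show ?thesis by (simp add: N_def)
qed

text \<open>
  The three-term recurrence, read as a differential equation whose leading coefficient is
  \<open>(1 - 32x)(1 + 4x)\<close>.
\<close>
lemma theta3_central_franel_fps:
  "(1 - 28 * X - 128 * X\<^sup>2) * theta (theta (theta central_franel_fps)) =
     X * (42 + 384 * X) * theta (theta central_franel_fps) + X * (22 + 352 * X) * theta central_franel_fps + X * (4 + 96 * X) * central_franel_fps"
proof -
  define T1 T2 T3 where T: "T1 = theta central_franel_fps" "T2 = theta T1" "T3 = theta T2"
  have T_nth: "T1 $ k = int k * central_franel k" "T2 $ k = int k * (int k * central_franel k)" "T3 $ k = int k * (int k * (int k * central_franel k))"
    "central_franel_fps $ k = central_franel k" for k
    by (simp_all add: T central_franel_fps_def)
  have "T3 = X * (28 * T3 + 42 * T2 + 22 * T1 + 4 * central_franel_fps) + X * (X * (128 * T3 + 384 * T2 + 352 * T1 + 96 * central_franel_fps))"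
    (is "_ = X * ?P + X * (X * ?Q)")
  proof (rule fps_ext)
    fix n :: nat
    consider "n = 0" | "n = 1" | m where "n = m + 2"
      by (metis One_nat_def add_2_eq_Suc' not0_implies_Suc)
    thus "T3 $ n = (X * ?P + X * (X * ?Q)) $ n"
    proof cases
      case 3
      have "(X * ?P + X * (X * ?Q)) $ n = ?P $ (m + 1) + ?Q $ m"
        using 3 by simp
      also have "\<dots> = (28 * (int m + 1) ^ 3 + 42 * (int m + 1)\<^sup>2 + 22 * (int m + 1) + 4) * central_franel (m + 1)
          + (128 * int m ^ 3 + 384 * (int m)\<^sup>2 + 352 * int m + 96) * central_franel m"
        by (simp only: fps_add_nth fps_X_mult_numeral_nth T_nth of_nat_add of_nat_1) (simp add: power_numeral_reduce algebra_simps)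
      also have "\<dots> = 2 * (2 * int m + 3) * (7 * (int m)\<^sup>2 + 21 * int m + 16) * central_franel (m + 1)
          + 32 * (int m + 1) * (2 * int m + 3) * (2 * int m + 1) * central_franel m"
        by (simp add: power_numeral_reduce algebra_simps)
      also have "\<dots> = T3 $ n"
        using 3 unfolding central_franel_recurrence[symmetric] by (simp only: T_nth power3_eq_cube of_nat_add of_nat_numeral mult.assoc)
      finally show ?thesis ..
    next
      case 2
      have "?P $ 0 = 4" by (simp add: T_nth fps_X_mult_numeral_nth(2))
      thus ?thesis using 2 by (simp only: fps_add_nth fps_X_mult_numeral_nth(1)) (simp add: T_nth)
    next
      case 1
      thus ?thesis by (simp only: fps_add_nth fps_X_mult_numeral_nth(1)) (simp add: T_nth)
    qed
  qed
  thus ?thesis unfolding T[symmetric] power2_eq_square by (simp add: algebra_simps)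
qed

text \<open>
  All terms are brought to the common factor \<open>e^-4\<close>; what remains are the polynomial identities above.
\<close>
lemma delta3_central_franel_compose:
  defines "H \<equiv> fe_inv * (central_franel_fps oo clausen_arg)"
  shows "delta (delta (delta H)) = 4 * (fa * fb) * delta H + 2 * delta (fa * fb) * H"
proof -
  define g0 where "g0 = central_franel_fps oo clausen_arg"
  define g1 where "g1 = theta central_franel_fps oo clausen_arg"
  define g2 where "g2 = theta (theta central_franel_fps) oo clausen_arg"
  define g3 where "g3 = theta (theta (theta central_franel_fps)) oo clausen_arg"
  define x where "x = X * fa"
  have phi0: "clausen_arg $ 0 = 0" by (simp add: clausen_arg_def power2_eq_square)
  note chain = delta_compose[OF phi0 delta_clausen_arg]
  note D = chain[of central_franel_fps, folded g0_def g1_def] chain[of "theta central_franel_fps", folded g1_def g2_def]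
    chain[of "theta (theta central_franel_fps)", folded g2_def g3_def]
  have phi: "clausen_arg = fe_inv\<^sup>2 * x" by (simp add: clausen_arg_def x_def)
  have "((1 - 28 * X - 128 * X\<^sup>2) * theta (theta (theta central_franel_fps))) oo clausen_arg =
     (X * (42 + 384 * X) * theta (theta central_franel_fps) + X * (22 + 352 * X) * theta central_franel_fps + X * (4 + 96 * X) * central_franel_fps) oo clausen_arg"
    by (simp only: theta3_central_franel_fps)
  hence ode: "(1 - 28 * clausen_arg - 128 * clausen_arg\<^sup>2) * g3 =
      clausen_arg * (42 + 384 * clausen_arg) * g2 + clausen_arg * (22 + 352 * clausen_arg) * g1 + clausen_arg * (4 + 96 * clausen_arg) * g0"
    unfolding power2_eq_square
    by (simp add: fps_compose_mult_distrib[OF phi0] fps_compose_add_distrib fps_compose_sub_distrib phi0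
        g0_def g1_def g2_def g3_def)
  \<comment> \<open>Negative powers of \<open>e\<close> with the common denominator \<open>e^4\<close>.\<close>
  have v1: "fe_inv = fe_inv ^ 4 * fe ^ 3" and v2: "fe_inv\<^sup>2 = fe_inv ^ 4 * fe\<^sup>2" and v3: "fe_inv ^ 3 = fe_inv ^ 4 * fe"
    using fe_inv_fe by (simp_all add: power_numeral_reduce algebra_simps)
  have v0: "1 = fe_inv ^ 4 * fe ^ 4"
    using fe_inv_fe by (simp flip: power_mult_distrib)
  have "1 - 28 * clausen_arg - 128 * clausen_arg\<^sup>2 = fe_inv ^ 4 * fe ^ 4 - 28 * (fe_inv\<^sup>2 * x) - 128 * (fe_inv ^ 4 * x\<^sup>2)"
    unfolding phi v0[symmetric] by (simp add: power_mult_distrib)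
  also have "\<dots> = fe_inv ^ 4 * (fe ^ 4 - 28 * x * fe\<^sup>2 - 128 * x\<^sup>2)"
    unfolding v2 by (simp add: algebra_simps)
  finally have c: "1 - 28 * clausen_arg - 128 * clausen_arg\<^sup>2 = fe_inv ^ 4 * fs\<^sup>2"
    by (simp add: clausen_identity_c x_def)
  have "delta (delta (delta H)) = fs * (fe_inv ^ 4 * fs\<^sup>2 * g3)
     + (6 * fe_inv ^ 4 * fA * fs\<^sup>2 + 3 * fe_inv ^ 3 * fs * delta fs) * g2
     + (11 * fe_inv ^ 4 * fA\<^sup>2 * fs + fe_inv ^ 3 * (4 * fs * delta fA + 5 * fA * delta fs) + fe_inv\<^sup>2 * delta (delta fs)) * g1
     + (6 * fe_inv ^ 4 * fA ^ 3 + 6 * fe_inv ^ 3 * fA * delta fA + fe_inv\<^sup>2 * delta (delta fA)) * g0"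
    unfolding H_def g0_def[symmetric]
    by (simp add: delta_simps delta_power delta_fe_inv D power_numeral_reduce algebra_simps del: delta_simps(4))
  also have "fe_inv ^ 4 * fs\<^sup>2 * g3 = fe_inv\<^sup>2 * x * ((42 + 384 * clausen_arg) * g2 + (22 + 352 * clausen_arg) * g1 + (4 + 96 * clausen_arg) * g0)"
    using ode unfolding c by (simp add: phi algebra_simps)
  also have "\<dots> = fe_inv ^ 4 * x * ((42 * fe\<^sup>2 + 384 * x) * g2 + (22 * fe\<^sup>2 + 352 * x) * g1 + (4 * fe\<^sup>2 + 96 * x) * g0)"
  proof -
    have "fe_inv\<^sup>2 * x * ((42 + 384 * clausen_arg) * g2 + (22 + 352 * clausen_arg) * g1 + (4 + 96 * clausen_arg) * g0)
       = fe_inv\<^sup>2 * x * (42 * g2 + 22 * g1 + 4 * g0) + fe_inv ^ 4 * x * x * (384 * g2 + 352 * g1 + 96 * g0)"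
      unfolding phi by (simp add: power_numeral_reduce algebra_simps)
    thus ?thesis unfolding v2 by (simp add: algebra_simps)
  qed
  finally have "delta (delta (delta H)) = fe_inv ^ 4 * (
       fs * (x * (42 * fe\<^sup>2 + 384 * x) + 6 * fA * fs + 3 * fe * delta fs) * g2
     + (11 * fA\<^sup>2 * fs + 4 * fe * fs * delta fA + 5 * fe * fA * delta fs + fe\<^sup>2 * delta (delta fs)
         + fs * x * (22 * fe\<^sup>2 + 352 * x)) * g1
     + (6 * fA ^ 3 + 6 * fe * fA * delta fA + fe\<^sup>2 * delta (delta fA) + fs * x * (4 * fe\<^sup>2 + 96 * x)) * g0)"
    unfolding v2 v3 by (simp add: power2_eq_square algebra_simps)
  also have "\<dots> = fe_inv ^ 4 * (4 * (fa * fb) * fe\<^sup>2 * fs * g1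
     + (4 * (fa * fb) * fe\<^sup>2 * fA + 2 * delta (fa * fb) * fe ^ 3) * g0)"
    unfolding x_def clausen_identity_0 clausen_identity_1 clausen_identity_2 by simp
  also have "\<dots> = 4 * (fa * fb) * ((fe_inv ^ 4 * fe\<^sup>2) * (fs * g1 + fA * g0)) + 2 * delta (fa * fb) * ((fe_inv ^ 4 * fe ^ 3) * g0)"
    by (simp add: algebra_simps)
  also have "\<dots> = 4 * (fa * fb) * (fe_inv\<^sup>2 * (fs * g1 + fA * g0)) + 2 * delta (fa * fb) * (fe_inv * g0)"
    unfolding v1[symmetric] v2[symmetric] ..
  also have "fe_inv\<^sup>2 * (fs * g1 + fA * g0) = delta H"
    unfolding H_def g0_def[symmetric]
    by (simp add: delta_simps delta_fe_inv D power2_eq_square algebra_simps)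
  finally show ?thesis by (simp add: H_def g0_def)
qed

text \<open>
  Both sides solve the symmetric square equation and have constant term \<open>1\<close>.
\<close>
theorem franel_clausen: "franel_fps\<^sup>2 = fe_inv * (central_franel_fps oo clausen_arg)"
proof -
  define W where "W = franel_fps * franel_fps - fe_inv * (central_franel_fps oo clausen_arg)"
  have "W = 0"
  proof (rule delta3_unique)
    show "delta (delta (delta W)) = (4 * (fa * fb)) * delta W + (2 * delta (fa * fb)) * W"
      unfolding W_def delta_simps(2) delta3_central_franel_compose delta3_square[OF delta2_franel_fps] by (simp only: algebra_simps)
    show "W $ 0 = 0"
      using fe_inv_fe by (auto simp: W_def franel_fps_def central_franel_fps_def central_franel_def fe_inv_def fe_def)
    show "(4 * (fa * fb)) $ 0 = 0" "(2 * delta (fa * fb)) $ 0 = 0"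
      by (simp_all add: fb_def delta_def)
  qed
  thus ?thesis by (simp add: W_def power2_eq_square)
qed

section \<open>A cubic transformation of the Franel generating function\<close>

text \<open>
  This is \<open>(3k)! / k!^3\<close>, written as a product of binomial coefficients to make integrality evident.
\<close>
definition multinom3 :: "nat \<Rightarrow> int" where "multinom3 k = int ((3 * k choose k) * (2 * k choose k))"
definition multinom3_fps :: "int fps" where "multinom3_fps = Abs_fps multinom3"

lemma multinom3_fact: "multinom3 k * fact k ^ 3 = fact (3 * k)"
proof -
  have f3: "fact k * fact (2 * k) * (3 * k choose k) = fact (3 * k)"
    using binomial_fact_lemma[of k "3 * k"] by simp
  have f2: "fact k * fact k * (2 * k choose k) = fact (2 * k)"
    using binomial_fact_lemma[of k "2 * k"] by simp
  have "(3 * k choose k) * (2 * k choose k) * fact k ^ 3 = fact (3 * k)"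
    unfolding f3[symmetric] f2[symmetric] by (simp only: power3_eq_cube ac_simps)
  hence "int ((3 * k choose k) * (2 * k choose k) * fact k ^ 3) = int (fact (3 * k))" by simp
  thus ?thesis by (simp add: multinom3_def)
qed

lemma multinom3_recurrence: "(int k + 1)\<^sup>2 * multinom3 (k + 1) = 3 * (3 * int k + 1) * (3 * int k + 2) * multinom3 k"
proof -
  have "((int k + 1)\<^sup>2 * multinom3 (k + 1)) * ((int k + 1) * fact k ^ 3) = multinom3 (k + 1) * fact (k + 1) ^ 3"
    by (simp add: power_numeral_reduce algebra_simps)
  also have "\<dots> = fact (3 * k + 3)" unfolding multinom3_fact by (simp add: algebra_simps)
  also have "\<dots> = (3 * int k + 1) * (3 * int k + 2) * (3 * int k + 3) * fact (3 * k)"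
    by (simp add: numeral_3_eq_3 fact_Suc) (simp add: algebra_simps)
  also have "\<dots> = (3 * (3 * int k + 1) * (3 * int k + 2) * multinom3 k) * ((int k + 1) * fact k ^ 3)"
    unfolding multinom3_fact[symmetric] by (simp add: algebra_simps)
  finally show ?thesis by simp
qed

lemma theta2_multinom3_fps: "(1 - 27 * X) * theta (theta multinom3_fps) = X * (27 * theta multinom3_fps + 6 * multinom3_fps)"
proof -
  define T1 T2 where T: "T1 = theta multinom3_fps" "T2 = theta T1"
  have T_nth: "T1 $ k = int k * multinom3 k" "T2 $ k = int k * (int k * multinom3 k)" "multinom3_fps $ k = multinom3 k" for k
    by (simp_all add: T multinom3_fps_def)
  have "T2 = X * (27 * T2 + 27 * T1 + 6 * multinom3_fps)" (is "_ = X * ?P")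
  proof (rule fps_ext)
    fix n :: nat
    show "T2 $ n = (X * ?P) $ n"
    proof (cases n)
      case (Suc m)
      have "(X * ?P) $ n = ?P $ m" using Suc by simp
      also have "\<dots> = 3 * (3 * int m + 1) * (3 * int m + 2) * multinom3 m"
        by (simp only: fps_add_nth fps_X_mult_numeral_nth T_nth) (simp add: algebra_simps)
      also have "\<dots> = T2 $ n"
        using Suc multinom3_recurrence[of m] by (simp add: T_nth power2_eq_square algebra_simps)
      finally show ?thesis ..
    qed (simp add: T_nth)
  qed
  thus ?thesis unfolding T[symmetric] by (simp add: algebra_simps)
qed

definition fd :: "int fps" where "fd = 1 - 2 * X"
definition fd_inv :: "int fps" where "fd_inv = fps_left_inverse fd 1"
definition cubic_arg :: "int fps" where "cubic_arg = fd_inv ^ 3 * X\<^sup>2"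

text \<open>
  \<open>\<rho> / (1 - 2z)\<close> is the logarithmic derivative of the cubic argument \<open>z^2/(1 - 2z)^3\<close>, and
  \<open>\<sigma> / (1 - 2z)^2\<close> is the derivative of \<open>1/(1 - 2z)\<close>, both with respect to \<open>\<delta>\<close>.
\<close>
definition frho :: "int fps" where "frho = 2 * fa * (1 + X)"
definition fsigma :: "int fps" where "fsigma = 2 * X * fa"

lemma fd_inv_fd: "fd_inv * fd = 1"
  unfolding fd_inv_def by (rule fps_left_inverse) (simp add: fd_def)

lemma delta_fd_inv: "delta fd_inv = fd_inv\<^sup>2 * fsigma"
proof -
  have "delta (fd_inv * fd) = 0" by (simp add: fd_inv_fd delta_simps)
  hence "delta fd_inv * fd = fd_inv * fsigma"
    by (simp add: delta_simps) (simp add: fd_def fsigma_def delta_simps algebra_simps)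
  hence "fd_inv * fd * delta fd_inv = fd_inv * fd_inv * fsigma" by (simp add: algebra_simps)
  thus ?thesis by (simp add: fd_inv_fd power2_eq_square)
qed

lemma delta_cubic_arg: "delta cubic_arg = cubic_arg * (fd_inv * frho)"
proof -
  have "delta cubic_arg = 3 * fd_inv ^ 4 * fsigma * X\<^sup>2 + 2 * fa * (fd_inv ^ 3 * X\<^sup>2)"
    by (simp add: cubic_arg_def delta_simps delta_power delta_fd_inv power_numeral_reduce algebra_simps)
  also have "fd_inv ^ 3 * X\<^sup>2 = fd_inv ^ 4 * fd * X\<^sup>2"
    using fd_inv_fd by (simp add: power_numeral_reduce algebra_simps)
  also have "3 * fd_inv ^ 4 * fsigma * X\<^sup>2 + 2 * fa * (fd_inv ^ 4 * fd * X\<^sup>2) = fd_inv ^ 4 * X\<^sup>2 * (3 * fsigma + 2 * fa * fd)"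
    by (simp add: algebra_simps)
  also have "3 * fsigma + 2 * fa * fd = frho"
    by (simp add: fsigma_def fd_def frho_def algebra_simps)
  finally show ?thesis by (simp add: cubic_arg_def power_numeral_reduce algebra_simps)
qed

text \<open>
  The hypergeometric equation has leading coefficient \<open>1 - 27w\<close>, and for the cubic argument
  this is \<open>a (1 + z) / (1 - 2z)^3\<close>, because \<open>(1 - 2z)^3 - 27 z^2 = (1 - 8z)(1 + z)^2\<close>.
\<close>
lemma delta2_multinom3_compose: "delta (delta (fd_inv * (multinom3_fps oo cubic_arg))) = fa * fb * (fd_inv * (multinom3_fps oo cubic_arg))"
proof -
  define p0 where "p0 = multinom3_fps oo cubic_arg"
  define p1 where "p1 = theta multinom3_fps oo cubic_arg"
  define p2 where "p2 = theta (theta multinom3_fps) oo cubic_arg"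
  have w0: "cubic_arg $ 0 = 0" by (simp add: cubic_arg_def power2_eq_square)
  note chain = delta_compose[OF w0 delta_cubic_arg]
  note D = chain[of multinom3_fps, folded p0_def p1_def] chain[of "theta multinom3_fps", folded p1_def p2_def]
  have "((1 - 27 * X) * theta (theta multinom3_fps)) oo cubic_arg = (X * (27 * theta multinom3_fps + 6 * multinom3_fps)) oo cubic_arg"
    by (simp only: theta2_multinom3_fps)
  hence ode: "(1 - 27 * cubic_arg) * p2 = cubic_arg * (27 * p1 + 6 * p0)"
    by (simp add: fps_compose_mult_distrib[OF w0] fps_compose_add_distrib fps_compose_sub_distrib w0
        p0_def p1_def p2_def)
  have u1: "fd_inv = fd_inv ^ 3 * fd\<^sup>2" and u2: "fd_inv\<^sup>2 = fd_inv ^ 3 * fd" and u0: "1 = fd_inv ^ 3 * fd ^ 3"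
    using fd_inv_fd by (simp_all add: power_numeral_reduce algebra_simps)
  have "fd ^ 3 - 27 * X\<^sup>2 = fa * (1 + X)"
    by (simp add: fd_def fa_def power_numeral_reduce algebra_simps)
  hence "fd_inv ^ 3 * (fa * (1 + X)) = fd_inv ^ 3 * fd ^ 3 - 27 * cubic_arg"
    by (simp add: cubic_arg_def algebra_simps flip: \<open>fd ^ 3 - 27 * X\<^sup>2 = fa * (1 + X)\<close>)
  hence w: "fd_inv ^ 3 * (fa * (1 + X)) = 1 - 27 * cubic_arg" by (simp flip: u0)
  have i1: "54 * frho * X\<^sup>2 + 3 * fsigma * frho + fd * delta frho = 0"
    by (simp add: frho_def fsigma_def fd_def fa_def delta_simps delta_power power_numeral_reduce algebra_simps)
  have i0: "12 * frho * X\<^sup>2 + 2 * fsigma\<^sup>2 + fd * delta fsigma = fa * fb * fd\<^sup>2"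
    by (simp add: frho_def fsigma_def fd_def fa_def fb_def delta_simps delta_power power_numeral_reduce algebra_simps)
  have "delta (delta (fd_inv * (multinom3_fps oo cubic_arg))) = fd_inv ^ 3 * frho\<^sup>2 * p2
      + (3 * fd_inv ^ 3 * fsigma * frho + fd_inv\<^sup>2 * delta frho) * p1
      + (2 * fd_inv ^ 3 * fsigma\<^sup>2 + fd_inv\<^sup>2 * delta fsigma) * p0"
    unfolding p0_def[symmetric]
    by (simp add: delta_simps delta_power delta_fd_inv D power_numeral_reduce algebra_simps)
  also have "fd_inv ^ 3 * frho\<^sup>2 * p2 = 2 * frho * ((fd_inv ^ 3 * (fa * (1 + X))) * p2)"
    by (simp add: frho_def power2_eq_square algebra_simps)
  also have "\<dots> = 2 * frho * (fd_inv ^ 3 * X\<^sup>2 * (27 * p1 + 6 * p0))"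
    unfolding w ode by (simp add: cubic_arg_def)
  finally have "delta (delta (fd_inv * (multinom3_fps oo cubic_arg))) = fd_inv ^ 3 * ((54 * frho * X\<^sup>2 + 3 * fsigma * frho + fd * delta frho) * p1
      + (12 * frho * X\<^sup>2 + 2 * fsigma\<^sup>2 + fd * delta fsigma) * p0)"
    unfolding u2 by (simp add: algebra_simps)
  also have "\<dots> = fa * fb * ((fd_inv ^ 3 * fd\<^sup>2) * p0)"
    unfolding i1 i0 by (simp add: algebra_simps)
  finally show ?thesis unfolding u1[symmetric] p0_def .
qed

theorem franel_cubic_transformation: "franel_fps = fd_inv * (multinom3_fps oo cubic_arg)"
proof -
  define W where "W = franel_fps - fd_inv * (multinom3_fps oo cubic_arg)"
  have "W = 0"
  proof (rule delta2_unique)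
    show "delta (delta W) = (fa * fb) * W"
      unfolding W_def delta_simps(2) delta2_multinom3_compose delta2_franel_fps by (simp only: algebra_simps)
    show "W $ 0 = 0"
      by (simp add: W_def franel_fps_def multinom3_fps_def multinom3_def fd_inv_def fd_def)
    show "(fa * fb) $ 0 = 0" by (simp add: fb_def)
  qed
  thus ?thesis by (simp add: W_def)
qed

section \<open>Truncation modulo a prime\<close>

text \<open>
  Congruence modulo the ideal generated by \<open>p\<close> and \<open>z^p\<close>.
\<close>
definition trunc_cong :: "nat \<Rightarrow> int fps \<Rightarrow> int fps \<Rightarrow> bool" where
  "trunc_cong p f g \<longleftrightarrow> (\<forall>n<p. [f $ n = g $ n] (mod int p))"

lemma trunc_cong_refl [simp]: "trunc_cong p f f" by (simp add: trunc_cong_def)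
lemma trunc_cong_sym: "trunc_cong p f g \<Longrightarrow> trunc_cong p g f" by (auto simp: trunc_cong_def cong_sym)
lemma trunc_cong_trans [trans]: "trunc_cong p f g \<Longrightarrow> trunc_cong p g h \<Longrightarrow> trunc_cong p f h"
  unfolding trunc_cong_def by (meson cong_trans)
lemma trunc_cong_mult: "trunc_cong p f f' \<Longrightarrow> trunc_cong p g g' \<Longrightarrow> trunc_cong p (f * g) (f' * g')"
  unfolding trunc_cong_def fps_mult_nth by (intro allI impI cong_sum cong_mult) auto
lemma trunc_cong_sum: "(\<And>k. k \<in> K \<Longrightarrow> trunc_cong p (f k) (g k)) \<Longrightarrow> trunc_cong p (sum f K) (sum g K)"
  unfolding trunc_cong_def fps_sum_nth by (intro allI impI cong_sum) auto

lemma dvd_fps_const_trunc_cong_0: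
  assumes "int p dvd c" shows "trunc_cong p (fps_const c * f) 0"
  using assms by (simp add: trunc_cong_def cong_0_iff)

text \<open>
  Frobenius: the inner binomial coefficients vanish modulo \<open>p\<close>, and the last term vanishes modulo
  \<open>z^p\<close>.
\<close>
lemma trunc_cong_one_plus_power:
  assumes "prime p"
  shows "trunc_cong p ((1 + X * f) ^ p) 1"
proof -
  have "(1 + X * f) ^ p = (\<Sum>k\<le>p. fps_const (int (p choose k)) * (X * f) ^ k)"
    using binomial_ring[of "X * f" 1 p] by (simp add: add.commute fps_of_nat)
  also have "trunc_cong p \<dots> (\<Sum>k\<le>p. if k = 0 then 1 else 0)"
  proof (rule trunc_cong_sum)
    fix k assume "k \<in> {..p}"
    then consider "k = 0" | "0 < k" "k < p" | "k = p" "p > 0" by force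
    thus "trunc_cong p (fps_const (int (p choose k)) * (X * f) ^ k) (if k = 0 then 1 else 0)"
    proof cases
      case 2
      hence "p dvd (p choose k)" using assms by (intro dvd_choose_prime) auto
      hence "trunc_cong p (fps_const (int (p choose k)) * (X * f) ^ k) 0"
        by (intro dvd_fps_const_trunc_cong_0) (simp only: int_dvd_int_iff)
      thus ?thesis using 2 by simp
    next
      case 3
      thus ?thesis by (simp add: trunc_cong_def power_mult_distrib fps_X_power_mult_nth)
    qed simp
  qed
  finally show ?thesis by simp
qed

text \<open>
  As \<open>(1 + z f)^p\<close> is \<open>1\<close>, negative exponents can be raised by \<open>p\<close>; this is how power series
  become polynomials.
\<close>
lemma trunc_cong_inverse_power:
  assumes "prime p" and "v * (1 + X * f) = 1" and "j \<le> p"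
  shows "trunc_cong p (v ^ j) ((1 + X * f) ^ (p - j))"
proof -
  define e where "e = 1 + X * f"
  have "e ^ (p - j) = e ^ (p - j) * (v * e) ^ j"
    using assms by (simp add: e_def)
  also have "\<dots> = v ^ j * e ^ ((p - j) + j)"
    by (simp only: power_mult_distrib power_add ac_simps)
  finally have "(1 + X * f) ^ (p - j) = v ^ j * (1 + X * f) ^ p"
    using assms(3) by (simp add: e_def)
  also have "trunc_cong p \<dots> (v ^ j * 1)"
    by (intro trunc_cong_mult trunc_cong_one_plus_power assms trunc_cong_refl)
  finally show ?thesis by (simp add: trunc_cong_sym)
qed

text \<open>
  The argument has no constant term, so its \<open>k\<close>-th power does not reach below \<open>z^k\<close>.
\<close>
lemma trunc_cong_compose:
  assumes "phi $ 0 = 0"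
  shows "trunc_cong p (f oo phi) (\<Sum>k<p. fps_const (f $ k) * phi ^ k)"
  unfolding trunc_cong_def
proof (intro allI impI)
  fix n assume n: "n < p"
  have "(f oo phi) $ n = (\<Sum>k\<in>{0..n}. f $ k * (phi ^ k) $ n)" by (simp add: fps_compose_nth)
  also have "\<dots> = (\<Sum>k<p. f $ k * (phi ^ k) $ n)"
    by (rule sum.mono_neutral_left) (use n assms in \<open>auto simp: startsby_zero_power_prefix\<close>)
  finally show "[(f oo phi) $ n = (\<Sum>k<p. fps_const (f $ k) * phi ^ k) $ n] (mod int p)"
    by (simp add: fps_sum_nth)
qed

lemma prime_not_dvd_fact:
  assumes "prime p" "k < p"
  shows "\<not> p dvd fact k" and "\<not> int p dvd fact k"
proof -
  show "\<not> p dvd fact k" using assms by (simp add: prime_dvd_fact_iff)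
  hence "\<not> int p dvd int (fact k)" by (simp only: int_dvd_int_iff not_False_eq_True)
  thus "\<not> int p dvd fact k" by simp
qed

lemma prime_dvd_multinom3:
  assumes "prime p" "k < p" "p \<le> 3 * k"
  shows "int p dvd multinom3 k"
proof -
  have "p dvd fact (3 * k)" using assms by (simp add: prime_dvd_fact_iff)
  hence "int p dvd int (fact (3 * k))" by (simp only: int_dvd_int_iff)
  hence "int p dvd multinom3 k * fact k ^ 3" by (simp add: multinom3_fact)
  thus ?thesis
    using assms prime_not_dvd_fact(2)[OF assms(1,2)] by (auto simp: prime_dvd_mult_iff prime_dvd_power_iff)
qed

lemma prime_dvd_central_franel:
  assumes "prime p" "k < p" "p \<le> 2 * k"
  shows "int p dvd central_franel k"
proof -
  have "fact k * fact k * (2 * k choose k) = (fact (2 * k) :: nat)"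
    using binomial_fact_lemma[of k "2 * k"] by simp
  moreover have "p dvd fact (2 * k)" using assms by (simp add: prime_dvd_fact_iff)
  ultimately have "p dvd fact k * fact k * (2 * k choose k)" by simp
  hence "p dvd (2 * k choose k)"
    using assms prime_not_dvd_fact(1)[OF assms(1,2)] by (auto simp: prime_dvd_mult_iff)
  thus ?thesis unfolding central_franel_def by (simp only: int_dvd_int_iff dvd_mult2)
qed

text \<open>
  The right-hand side of the Clausen formula after truncation: \<open>e^(p - 1)\<close> times the polynomial
  \<open>\<Sum> U k x^k\<close> at \<open>x = z a / e^2\<close>. Below, \<open>cubic_poly\<close> is the analogue for the cubic transformation.
\<close>
definition clausen_poly :: "nat \<Rightarrow> int poly" where
  "clausen_poly p = (\<Sum>k | 2 * k < p. smult (central_franel k) ([:0, 1, -7, -8:] ^ k * [:1, 0, 8:] ^ (p - 1 - 2 * k)))"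

definition cubic_poly :: "nat \<Rightarrow> int poly" where
  "cubic_poly p = (\<Sum>k | 3 * k < p. smult (multinom3 k) ([:0, 0, 1:] ^ k * [:1, -2:] ^ (p - 1 - 3 * k)))"

lemma fps_of_poly_eqs:
  "fps_of_poly [:0, 1, -7, -8:] = X * fa" "fps_of_poly [:1, 0, 8:] = fe"
  "fps_of_poly [:0, 0, 1:] = X\<^sup>2" "fps_of_poly [:1, -2:] = fd"
  by (simp_all add: fa_def fe_def fd_def fps_of_poly_pCons power2_eq_square numeral_fps_const algebra_simps)

lemma franel_fps_cong_cubic_poly:
  assumes "prime p"
  shows "trunc_cong p franel_fps (fps_of_poly (cubic_poly p))"
proof -
  have fd: "fd = 1 + X * (-2)" by (simp add: fd_def)
  have "trunc_cong p franel_fps (fd_inv * (\<Sum>k<p. fps_const (multinom3_fps $ k) * cubic_arg ^ k))"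
    unfolding franel_cubic_transformation by (intro trunc_cong_mult trunc_cong_compose trunc_cong_refl) (simp add: cubic_arg_def power2_eq_square)
  also have "fd_inv * (\<Sum>k<p. fps_const (multinom3_fps $ k) * cubic_arg ^ k) =
     (\<Sum>k<p. fps_const (multinom3 k) * (X\<^sup>2 ^ k * fd_inv ^ (3 * k + 1)))"
    by (simp only: sum_distrib_left multinom3_fps_def fps_nth_Abs_fps cubic_arg_def power_mult_distrib power_mult[symmetric]
        power_add power_one_right ac_simps)
  also have "trunc_cong p \<dots> (\<Sum>k<p. if 3 * k < p then fps_const (multinom3 k) * (X\<^sup>2 ^ k * fd ^ (p - (3 * k + 1))) else 0)"
  proof (rule trunc_cong_sum)
    fix k assume k: "k \<in> {..<p}"
    show "trunc_cong p (fps_const (multinom3 k) * (X\<^sup>2 ^ k * fd_inv ^ (3 * k + 1)))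
       (if 3 * k < p then fps_const (multinom3 k) * (X\<^sup>2 ^ k * fd ^ (p - (3 * k + 1))) else 0)"
    proof (cases "3 * k < p")
      case True
      have "trunc_cong p (fd_inv ^ (3 * k + 1)) (fd ^ (p - (3 * k + 1)))"
        unfolding fd by (rule trunc_cong_inverse_power) (use assms True fd_inv_fd fd in auto)
      thus ?thesis unfolding if_P[OF True] by (intro trunc_cong_mult trunc_cong_refl)
    next
      case False
      thus ?thesis using assms k by (simp only: if_False) (intro dvd_fps_const_trunc_cong_0 prime_dvd_multinom3; simp)
    qed
  qed
  also have "(\<Sum>k<p. if 3 * k < p then fps_const (multinom3 k) * (X\<^sup>2 ^ k * fd ^ (p - (3 * k + 1))) else 0)
      = (\<Sum>k | 3 * k < p. fps_const (multinom3 k) * (X\<^sup>2 ^ k * fd ^ (p - (3 * k + 1))))"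
    by (rule sum.mono_neutral_cong_right) auto
  also have "\<dots> = fps_of_poly (cubic_poly p)"
    by (simp add: cubic_poly_def fps_of_poly_sum fps_of_poly_smult fps_of_poly_mult fps_of_poly_power fps_of_poly_eqs)
  finally show ?thesis .
qed

lemma franel_fps_squared_cong_clausen_poly:
  assumes "prime p"
  shows "trunc_cong p (franel_fps\<^sup>2) (fps_of_poly (clausen_poly p))"
proof -
  have fe: "fe = 1 + X * (8 * X)" by (simp add: fe_def power2_eq_square algebra_simps)
  have "trunc_cong p (franel_fps\<^sup>2) (fe_inv * (\<Sum>k<p. fps_const (central_franel_fps $ k) * clausen_arg ^ k))"
    unfolding franel_clausen by (intro trunc_cong_mult trunc_cong_compose trunc_cong_refl) (simp add: clausen_arg_def)
  also have "fe_inv * (\<Sum>k<p. fps_const (central_franel_fps $ k) * clausen_arg ^ k) =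
     (\<Sum>k<p. fps_const (central_franel k) * ((X * fa) ^ k * fe_inv ^ (2 * k + 1)))"
    by (simp only: sum_distrib_left central_franel_fps_def fps_nth_Abs_fps clausen_arg_def power_mult_distrib power_mult[symmetric]
        power_add power_one_right ac_simps)
  also have "trunc_cong p \<dots> (\<Sum>k<p. if 2 * k < p then fps_const (central_franel k) * ((X * fa) ^ k * fe ^ (p - (2 * k + 1))) else 0)"
  proof (rule trunc_cong_sum)
    fix k assume k: "k \<in> {..<p}"
    show "trunc_cong p (fps_const (central_franel k) * ((X * fa) ^ k * fe_inv ^ (2 * k + 1)))
       (if 2 * k < p then fps_const (central_franel k) * ((X * fa) ^ k * fe ^ (p - (2 * k + 1))) else 0)"
    proof (cases "2 * k < p")
      case True
      have "trunc_cong p (fe_inv ^ (2 * k + 1)) (fe ^ (p - (2 * k + 1)))"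
        unfolding fe by (rule trunc_cong_inverse_power) (use assms True fe_inv_fe fe in auto)
      thus ?thesis unfolding if_P[OF True] by (intro trunc_cong_mult trunc_cong_refl)
    next
      case False
      thus ?thesis using assms k by (simp only: if_False) (intro dvd_fps_const_trunc_cong_0 prime_dvd_central_franel; simp)
    qed
  qed
  also have "(\<Sum>k<p. if 2 * k < p then fps_const (central_franel k) * ((X * fa) ^ k * fe ^ (p - (2 * k + 1))) else 0)
      = (\<Sum>k | 2 * k < p. fps_const (central_franel k) * ((X * fa) ^ k * fe ^ (p - (2 * k + 1))))"
    by (rule sum.mono_neutral_cong_right) auto
  also have "\<dots> = fps_of_poly (clausen_poly p)"
    by (simp add: clausen_poly_def fps_of_poly_sum fps_of_poly_smult fps_of_poly_mult fps_of_poly_power fps_of_poly_eqs)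
  finally show ?thesis .
qed

lemma coeff_clausen_poly_cong:
  assumes "prime p" "n < p"
  shows "[coeff (clausen_poly p) n = coeff ((cubic_poly p)\<^sup>2) n] (mod int p)"
proof -
  have "trunc_cong p (fps_of_poly (clausen_poly p)) (franel_fps\<^sup>2)"
    using franel_fps_squared_cong_clausen_poly[OF assms(1)] by (rule trunc_cong_sym)
  also have "trunc_cong p (franel_fps\<^sup>2) (fps_of_poly (cubic_poly p) * fps_of_poly (cubic_poly p))"
    unfolding power2_eq_square by (intro trunc_cong_mult franel_fps_cong_cubic_poly assms)
  finally show ?thesis
    using assms(2) by (auto simp: trunc_cong_def power2_eq_square simp flip: fps_of_poly_mult)
qed

section \<open>Reflection symmetry modulo a prime\<close>

lemma binomial_prime_minus_one_cong:
  assumes "prime p" "k < p"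
  shows "[int ((p - 1) choose k) = (-1) ^ k] (mod int p)"
  using assms(2)
proof (induction k)
  case (Suc k)
  have "int (p choose Suc k) = int ((p - 1) choose k) + int ((p - 1) choose Suc k)"
    using assms(1) prime_gt_0_nat[of p] by (cases p) auto
  moreover have "p dvd (p choose Suc k)" using assms Suc.prems by (intro dvd_choose_prime) auto
  hence "int p dvd int (p choose Suc k)" by (simp only: int_dvd_int_iff)
  ultimately have "[int ((p - 1) choose k) + int ((p - 1) choose Suc k) = (-1) ^ k + (-1) ^ Suc k] (mod int p)"
    by (simp add: cong_0_iff)
  moreover have "[int ((p - 1) choose k) = (-1) ^ k] (mod int p)" using Suc by simp
  ultimately show ?case by (metis cong_add_lcancel cong_add_rcancel cong_trans cong_sym)
qed simp

lemma franel_prime_minus_one: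
  assumes "prime p" "odd p"
  shows "[int (franel (p - 1)) = 1] (mod int p)"
proof -
  have "int (franel (p - 1)) = (\<Sum>k\<le>p - 1. int ((p - 1) choose k) ^ 3)"
    by (simp add: franel_def)
  also have "[\<dots> = (\<Sum>k\<le>p - 1. ((-1) ^ k) ^ 3)] (mod int p)"
    using assms prime_gt_0_nat[of p]
    by (intro cong_sum cong_pow binomial_prime_minus_one_cong) auto
  also have "(\<Sum>k\<le>p - 1. ((-1) ^ k) ^ 3 :: int) = (\<Sum>k\<le>p - 1. (-1) ^ k)"
    by (simp flip: power_mult) (simp add: power_mult mult.commute[of _ 3])
  also have "\<dots> = 1"
  proof -
    have "(\<Sum>k\<le>2 * m. (-1) ^ k :: int) = 1" for m by (induction m) auto
    thus ?thesis using assms(2) by (metis dvd_def odd_two_times_div_two_nat)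
  qed
  finally show ?thesis .
qed

lemma coprime_Suc_prime: "prime p \<Longrightarrow> Suc k < p \<Longrightarrow> coprime (int k + 1) (int p)"
proof -
  assume "prime p" "Suc k < p"
  hence "coprime (Suc k) p" by (metis coprime_commute nat_dvd_not_less prime_imp_coprime zero_less_Suc)
  hence "coprime (int (Suc k)) (int p)" by (simp only: coprime_int_iff)
  thus ?thesis by (simp add: add.commute)
qed

text \<open>
  The substitution of \<open>p - 1 - j\<close> for \<open>j\<close> maps the Franel recurrence modulo \<open>p\<close> to itself, up to the
  scaling by powers of \<open>-8\<close>, and the initial values \<open>f (p - 1)\<close> and \<open>f 0\<close> agree.
\<close>
lemma franel_reflect:
  assumes p: "prime p" "odd p" and "j < p"
  shows "[(-8) ^ j * int (franel (p - 1 - j)) = int (franel j)] (mod int p)"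
  using assms(3)
proof (induction j rule: less_induct)
  case (less j)
  show ?case
  proof (cases j)
    case 0
    thus ?thesis using franel_prime_minus_one[OF p] by simp
  next
    case (Suc i)
    define n where "n = p - 2 - i"
    define f where "f k = int (franel k)" for k
    define g where "g k = (-8) ^ k * f (p - 1 - k)" for k
    have n: "p = n + i + 2" using less.prems Suc by (simp add: n_def)
    have ni: "[int n = - (int i + 2)] (mod int p)"
    proof -
      have "int n - (- (int i + 2)) = int p" by (simp add: n)
      thus ?thesis by (simp only: cong_iff_dvd_diff dvd_refl)
    qed
    have "[(int n + 2)\<^sup>2 * f (n + 2) = (7 * (int n)\<^sup>2 + 21 * int n + 16) * f (n + 1) + 8 * (int n + 1)\<^sup>2 * f n] (mod int p)"
      using franel_recurrence[of n] by (simp add: f_def)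
    moreover have "[(int n + 2)\<^sup>2 * f (n + 2) = (- (int i + 2) + 2)\<^sup>2 * f (n + 2)] (mod int p)"
      by (intro cong_mult cong_pow cong_add cong_refl ni)
    moreover have "[(7 * (int n)\<^sup>2 + 21 * int n + 16) * f (n + 1) + 8 * (int n + 1)\<^sup>2 * f n
       = (7 * (- (int i + 2))\<^sup>2 + 21 * (- (int i + 2)) + 16) * f (n + 1) + 8 * (- (int i + 2) + 1)\<^sup>2 * f n] (mod int p)"
      by (intro cong_mult cong_pow cong_add cong_refl ni)
    ultimately have "[(- (int i + 2) + 2)\<^sup>2 * f (n + 2) =
       (7 * (- (int i + 2))\<^sup>2 + 21 * (- (int i + 2)) + 16) * f (n + 1) + 8 * (- (int i + 2) + 1)\<^sup>2 * f n] (mod int p)"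
      by (meson cong_sym cong_trans)
    hence "int p dvd (int i)\<^sup>2 * f (n + 2) - ((7 * (int i)\<^sup>2 + 7 * int i + 2) * f (n + 1) + 8 * (int i + 1)\<^sup>2 * f n)"
      by (simp add: cong_iff_dvd_diff power2_eq_square algebra_simps)
    hence "int p dvd - ((-8) ^ i) * ((int i)\<^sup>2 * f (n + 2) - ((7 * (int i)\<^sup>2 + 7 * int i + 2) * f (n + 1) + 8 * (int i + 1)\<^sup>2 * f n))"
      by (rule dvd_mult)
    also have "- ((-8) ^ i) * ((int i)\<^sup>2 * f (n + 2) - ((7 * (int i)\<^sup>2 + 7 * int i + 2) * f (n + 1) + 8 * (int i + 1)\<^sup>2 * f n))
       = (7 * (int i)\<^sup>2 + 7 * int i + 2) * ((-8) ^ i * f (n + 1)) - (int i)\<^sup>2 * ((-8) ^ i * f (n + 2)) - (int i + 1)\<^sup>2 * ((-8) ^ Suc i * f n)"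
      by (simp add: algebra_simps)
    finally have main: "[(int i + 1)\<^sup>2 * g (Suc i) = (7 * (int i)\<^sup>2 + 7 * int i + 2) * g i - (int i)\<^sup>2 * ((-8) ^ i * f (n + 2))] (mod int p)"
      unfolding g_def n by (subst cong_sym_eq) (simp add: cong_iff_dvd_diff)
    have gi: "[g i = f i] (mod int p)" using less.IH[of i] less.prems Suc by (simp add: g_def f_def)
    have "[(int i)\<^sup>2 * ((-8) ^ i * f (n + 2)) = - (8 * (int i)\<^sup>2 * f (i - 1))] (mod int p)"
    proof (cases i)
      case (Suc l)
      have "p - 1 - l = n + 2" using n Suc by simp
      hence "[g l = f l] (mod int p)" "g l = (-8) ^ l * f (n + 2)"
        using less.IH[of l] less.prems \<open>j = Suc i\<close> Suc by (simp_all add: g_def f_def)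
      hence "[(- 8 * (int i)\<^sup>2) * ((-8) ^ l * f (n + 2)) = (- 8 * (int i)\<^sup>2) * f l] (mod int p)"
        by (intro cong_mult cong_refl) simp
      thus ?thesis using Suc by (simp add: algebra_simps)
    qed simp
    hence "[(int i + 1)\<^sup>2 * g (Suc i) = (7 * (int i)\<^sup>2 + 7 * int i + 2) * f i - (- (8 * (int i)\<^sup>2 * f (i - 1)))] (mod int p)"
      by (rule cong_trans[OF main cong_diff[OF cong_mult[OF cong_refl gi]]])
    also have "(7 * (int i)\<^sup>2 + 7 * int i + 2) * f i - (- (8 * (int i)\<^sup>2 * f (i - 1))) = (int i + 1)\<^sup>2 * f (Suc i)"
      using franel_recurrence[of "i - 1"] by (cases i) (simp_all add: f_def power2_eq_square algebra_simps)
    finally have "[(int i + 1)\<^sup>2 * g (Suc i) = (int i + 1)\<^sup>2 * f (Suc i)] (mod int p)" .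
    moreover have "coprime ((int i + 1)\<^sup>2) (int p)"
      using coprime_Suc_prime[OF p(1), of i] less.prems Suc by simp
    ultimately have "[g (Suc i) = f (Suc i)] (mod int p)" by (simp add: cong_mult_lcancel)
    thus ?thesis using Suc by (simp add: g_def f_def)
  qed
qed

text \<open>
  Modulo \<open>p\<close>, a polynomial of formal degree \<open>M\<close> is mapped to a multiple of itself by the substitution
  \<open>z \<mapsto> -1/(8z)\<close>, followed by multiplication with \<open>z^M\<close>. For coefficients this relates positions \<open>j\<close> and \<open>M - j\<close>, and the scaling
  is arranged so that the constant \<open>c\<close> is multiplicative and no power of \<open>8\<close> is inverted.
\<close>
definition self_reciprocal :: "nat \<Rightarrow> nat \<Rightarrow> int \<Rightarrow> int poly \<Rightarrow> bool" where
  "self_reciprocal p M c f \<longleftrightarrow> degree f \<le> M \<and> (\<forall>j\<le>M. [(-8) ^ j * coeff f (M - j) = c * coeff f j] (mod int p))"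

lemma self_reciprocal_1: "self_reciprocal p 0 1 1" by (simp add: self_reciprocal_def)

lemma self_reciprocal_mult:
  assumes f: "self_reciprocal p M c f" and g: "self_reciprocal p N d g"
  shows "self_reciprocal p (M + N) (c * d) (f * g)"
  unfolding self_reciprocal_def
proof (intro conjI allI impI)
  have deg: "degree f \<le> M" "degree g \<le> N" using f g by (auto simp: self_reciprocal_def)
  show "degree (f * g) \<le> M + N" using deg degree_mult_le[of f g] by linarith
  fix j assume j: "j \<le> M + N"
  define S where "S = {i. i \<le> j \<and> i \<le> M \<and> j - i \<le> N}"
  have fin: "finite S" by (rule finite_subset[of _ "{..M}"]) (auto simp: S_def)
  have "coeff (f * g) (M + N - j) = (\<Sum>i\<le>M + N - j. coeff f i * coeff g (M + N - j - i))"
    by (simp add: coeff_mult)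
  also have "\<dots> = (\<Sum>i | i \<le> M \<and> M \<le> i + j \<and> i + j \<le> M + N. coeff f i * coeff g (M + N - j - i))"
    by (rule sum.mono_neutral_right) (use deg j in \<open>auto dest!: le_degree\<close>)
  also have "\<dots> = (\<Sum>i\<in>S. coeff f (M - i) * coeff g (N - (j - i)))"
    by (rule sum.reindex_bij_witness[of _ "\<lambda>i. M - i" "\<lambda>i. M - i"]) (use j in \<open>auto simp: S_def add.commute\<close>)
  finally have "(-8) ^ j * coeff (f * g) (M + N - j) =
      (\<Sum>i\<in>S. ((-8) ^ i * coeff f (M - i)) * ((-8) ^ (j - i) * coeff g (N - (j - i))))"
    by (auto simp: sum_distrib_left S_def algebra_simps simp flip: power_add intro!: sum.cong)
  also have "[\<dots> = (\<Sum>i\<in>S. (c * coeff f i) * (d * coeff g (j - i)))] (mod int p)"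
  proof (rule cong_sum)
    fix i assume "i \<in> S"
    hence "i \<le> M" "j - i \<le> N" by (auto simp: S_def)
    with f g show "[((-8) ^ i * coeff f (M - i)) * ((-8) ^ (j - i) * coeff g (N - (j - i))) =
        (c * coeff f i) * (d * coeff g (j - i))] (mod int p)"
      unfolding self_reciprocal_def by (blast intro: cong_mult)
  qed
  also have "(\<Sum>i\<in>S. (c * coeff f i) * (d * coeff g (j - i))) = c * d * (\<Sum>i\<in>S. coeff f i * coeff g (j - i))"
    by (simp add: sum_distrib_left algebra_simps)
  also have "(\<Sum>i\<in>S. coeff f i * coeff g (j - i)) = (\<Sum>i\<le>j. coeff f i * coeff g (j - i))"
    by (rule sum.mono_neutral_left) (use deg in \<open>auto simp: S_def dest!: le_degree\<close>)
  also have "\<dots> = coeff (f * g) j" by (simp add: coeff_mult)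
  finally show "[(-8) ^ j * coeff (f * g) (M + N - j) = c * d * coeff (f * g) j] (mod int p)" .
qed

lemma self_reciprocal_power: "self_reciprocal p M c f \<Longrightarrow> self_reciprocal p (k * M) (c ^ k) (f ^ k)"
  by (induction k) (auto intro: self_reciprocal_mult self_reciprocal_1)

lemma self_reciprocal_smult: "self_reciprocal p M c f \<Longrightarrow> self_reciprocal p M c (smult a f)"
  unfolding self_reciprocal_def
proof (intro conjI allI impI; elim conjE)
  assume "degree f \<le> M"
  thus "degree (smult a f) \<le> M" by (meson degree_smult_le order.trans)
next
  fix j assume "j \<le> M" "\<forall>j\<le>M. [(-8) ^ j * coeff f (M - j) = c * coeff f j] (mod int p)"
  hence "[a * ((-8) ^ j * coeff f (M - j)) = a * (c * coeff f j)] (mod int p)"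
    by (intro cong_scalar_left) simp
  thus "[(-8) ^ j * coeff (smult a f) (M - j) = c * coeff (smult a f) j] (mod int p)"
    by (simp add: mult.left_commute)
qed

lemma self_reciprocal_add: "self_reciprocal p M c f \<Longrightarrow> self_reciprocal p M c g \<Longrightarrow> self_reciprocal p M c (f + g)"
  unfolding self_reciprocal_def by (auto intro: degree_add_le cong_add simp: distrib_left)

lemma self_reciprocal_0: "self_reciprocal p M c 0" by (simp add: self_reciprocal_def)

lemma self_reciprocal_sum: "(\<And>k. k \<in> K \<Longrightarrow> self_reciprocal p M c (f k)) \<Longrightarrow> self_reciprocal p M c (sum f K)"
  by (induction K rule: infinite_finite_induct) (auto intro: self_reciprocal_add self_reciprocal_0)

lemma self_reciprocal_diff: "self_reciprocal p M c f \<Longrightarrow> self_reciprocal p M c g \<Longrightarrow> self_reciprocal p M c (f - g)"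
  using self_reciprocal_add[of p M c f "smult (-1) g"] self_reciprocal_smult[of p M c g "-1"] by simp

lemma self_reciprocal_cong: "self_reciprocal p M c f \<Longrightarrow> [c = d] (mod int p) \<Longrightarrow> self_reciprocal p M d f"
  unfolding self_reciprocal_def by (meson cong_mult cong_refl cong_trans)

lemma fermat_int:
  assumes "prime p" "\<not> p dvd a"
  shows "[int a ^ (p - 1) = 1] (mod int p)"
  using fermat_theorem[OF assms] by (metis cong_int_iff of_nat_1 of_nat_power)

lemma odd_prime_not_dvd_8:
  fixes p :: nat
  assumes "prime p" "odd p" shows "\<not> p dvd 8"
proof
  assume "p dvd 8"
  hence "p dvd 2 ^ 3" by simp
  hence "p dvd 2" using assms(1) by (rule prime_dvd_power[rotated])
  hence "p \<le> 2" by (rule dvd_imp_le) simp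
  hence "p = 2" using prime_ge_2_nat[OF assms(1)] by simp
  thus False using assms(2) by simp
qed

text \<open>
  Both \<open>z a\<close> (formal degree \<open>4\<close>, constant \<open>8^2\<close>) and \<open>e\<close> (formal degree \<open>2\<close>, constant \<open>8\<close>) are
  self-reciprocal, so every summand has formal degree \<open>2(p - 1)\<close> and constant \<open>8^(p - 1)\<close>.
\<close>
lemma self_reciprocal_clausen_poly:
  assumes p: "prime p" "odd p"
  shows "self_reciprocal p (2 * (p - 1)) 1 (clausen_poly p)"
proof -
  have za: "self_reciprocal p 4 64 [:0, 1, -7, -8:]"
    by (auto simp: self_reciprocal_def numeral_eq_Suc le_Suc_eq)
  have e: "self_reciprocal p 2 8 [:1, 0, 8:]"
    by (auto simp: self_reciprocal_def numeral_eq_Suc le_Suc_eq)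
  have "self_reciprocal p (2 * (p - 1)) (8 ^ (p - 1)) (clausen_poly p)"
    unfolding clausen_poly_def
  proof (intro self_reciprocal_sum self_reciprocal_smult)
    fix k assume "k \<in> {k. 2 * k < p}"
    hence k: "2 * k + (p - 1 - 2 * k) = p - 1" by simp
    have "self_reciprocal p (k * 4 + (p - 1 - 2 * k) * 2) (64 ^ k * 8 ^ (p - 1 - 2 * k))
       ([:0, 1, -7, -8:] ^ k * [:1, 0, 8:] ^ (p - 1 - 2 * k))"
      by (intro self_reciprocal_mult self_reciprocal_power za e)
    moreover have "k * 4 + (p - 1 - 2 * k) * 2 = 2 * (p - 1)" using k by linarith
    moreover have "64 ^ k * 8 ^ (p - 1 - 2 * k) = (8 :: int) ^ (2 * k + (p - 1 - 2 * k))"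
      by (simp add: power_add power_mult)
    ultimately show "self_reciprocal p (2 * (p - 1)) (8 ^ (p - 1)) ([:0, 1, -7, -8:] ^ k * [:1, 0, 8:] ^ (p - 1 - 2 * k))"
      by (simp only: k)
  qed
  moreover have "[8 ^ (p - 1) = 1] (mod int p)"
    using fermat_int[OF p(1) odd_prime_not_dvd_8[OF p]] by simp
  ultimately show ?thesis by (rule self_reciprocal_cong)
qed

text \<open>
  The symmetry is invisible in the defining sum. It holds because the coefficients are the Franel
  numbers \<open>f 0, \<dots>, f (p - 1)\<close> modulo \<open>p\<close>.
\<close>
lemma self_reciprocal_cubic_poly:
  assumes p: "prime p" "odd p"
  shows "self_reciprocal p (p - 1) 1 (cubic_poly p)"
  unfolding self_reciprocal_def
proof (intro conjI allI impI)
  show "degree (cubic_poly p) \<le> p - 1"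
    unfolding cubic_poly_def
  proof (rule degree_sum_le)
    show "finite {k. 3 * k < p}" by (rule finite_subset[of _ "{..<p}"]) auto
    fix k assume "k \<in> {k. 3 * k < p}"
    moreover have "degree ([:0, 0, 1 :: int:] ^ k * [:1, -2:] ^ (p - 1 - 3 * k)) \<le> 2 * k + (p - 1 - 3 * k)"
      by (simp add: degree_mult_eq degree_power_eq)
    ultimately show "degree (smult (multinom3 k) ([:0, 0, 1:] ^ k * [:1, -2:] ^ (p - 1 - 3 * k))) \<le> p - 1"
      by (intro order.trans[OF degree_smult_le]) auto
  qed
  have Q: "[coeff (cubic_poly p) n = int (franel n)] (mod int p)" if "n < p" for n
    using franel_fps_cong_cubic_poly[OF p(1)] that by (simp add: trunc_cong_def franel_fps_def cong_sym_eq)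
  fix j assume "j \<le> p - 1"
  hence j: "j < p" "p - 1 - j < p" using prime_gt_0_nat[OF p(1)] by auto
  have "[(-8) ^ j * coeff (cubic_poly p) (p - 1 - j) = (-8) ^ j * int (franel (p - 1 - j))] (mod int p)"
    by (intro cong_mult cong_refl Q j)
  also have "[(-8) ^ j * int (franel (p - 1 - j)) = int (franel j)] (mod int p)"
    by (rule franel_reflect[OF p j(1)])
  also have "[int (franel j) = coeff (cubic_poly p) j] (mod int p)"
    using Q[OF j(1)] by (rule cong_sym)
  finally show "[(-8) ^ j * coeff (cubic_poly p) (p - 1 - j) = 1 * coeff (cubic_poly p) j] (mod int p)" by simp
qed

text \<open>
  The low half of the coefficients comes from the power series identities, and the high half from
  the reflection symmetry.
\<close>
theorem clausen_poly_cong_cubic_poly_squared: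
  assumes p: "prime p" "odd p"
  shows "[:int p:] dvd clausen_poly p - (cubic_poly p)\<^sup>2"
  unfolding const_poly_dvd_iff
proof
  fix n
  define D where "D = clausen_poly p - (cubic_poly p)\<^sup>2"
  have "self_reciprocal p (2 * (p - 1)) 1 ((cubic_poly p)\<^sup>2)"
    using self_reciprocal_power[OF self_reciprocal_cubic_poly[OF p], of 2] by simp
  hence D: "self_reciprocal p (2 * (p - 1)) 1 D"
    unfolding D_def by (intro self_reciprocal_diff self_reciprocal_clausen_poly p)
  have low: "int p dvd coeff D n" if "n < p" for n
    using coeff_clausen_poly_cong[OF p(1) that] by (simp add: D_def cong_iff_dvd_diff)
  consider "n < p" | "p \<le> n" "n \<le> 2 * (p - 1)" | "2 * (p - 1) < n" by linarith
  hence "int p dvd coeff D n"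
  proof cases
    case 2
    define j where "j = 2 * (p - 1) - n"
    have j: "j < p" "j \<le> 2 * (p - 1)" "2 * (p - 1) - j = n" using 2 prime_gt_0_nat[OF p(1)] by (auto simp: j_def)
    hence "[(-8) ^ j * coeff D n = coeff D j] (mod int p)"
      using D by (auto simp: self_reciprocal_def)
    hence "int p dvd (-8) ^ j * coeff D n"
      using low[OF j(1)] by (simp add: cong_dvd_iff)
    moreover have "\<not> int p dvd (-8) ^ j"
    proof
      assume "int p dvd (-8) ^ j"
      hence "int p dvd -8" using p(1) prime_dvd_power[of "int p" "-8" j] by simp
      hence "int p dvd int 8" by simp
      thus False using odd_prime_not_dvd_8[OF p] by (simp only: int_dvd_int_iff)
    qed
    ultimately show ?thesis using p(1) by (simp add: prime_dvd_mult_iff)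
  qed (use low D in \<open>auto simp: self_reciprocal_def coeff_eq_0\<close>)
  thus "int p dvd coeff (clausen_poly p - (cubic_poly p)\<^sup>2) n" by (simp add: D_def)
qed

section \<open>Specialization at a point of a real quadratic field\<close>

definition eval_int_poly :: "real \<Rightarrow> int poly \<Rightarrow> real" where "eval_int_poly x f = poly (map_poly of_int f) x"

lemma eval_int_poly_0 [simp]: "eval_int_poly x 0 = 0" by (simp add: eval_int_poly_def)
lemma eval_int_poly_pCons [simp]: "eval_int_poly x (pCons c f) = of_int c + x * eval_int_poly x f"
  by (simp add: eval_int_poly_def map_poly_pCons)
lemma eval_int_poly_add [simp]: "eval_int_poly x (f + g) = eval_int_poly x f + eval_int_poly x g"
proof -
  have "map_poly real_of_int (f + g) = map_poly of_int f + map_poly of_int g"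
    by (rule poly_eqI) (simp add: coeff_map_poly)
  thus ?thesis by (simp add: eval_int_poly_def)
qed
lemma eval_int_poly_smult [simp]: "eval_int_poly x (smult c f) = of_int c * eval_int_poly x f"
proof -
  have "map_poly real_of_int (smult c f) = smult (of_int c) (map_poly of_int f)"
    by (rule poly_eqI) (simp add: coeff_map_poly)
  thus ?thesis by (simp add: eval_int_poly_def)
qed
lemma eval_int_poly_mult [simp]: "eval_int_poly x (f * g) = eval_int_poly x f * eval_int_poly x g"
  by (induction f) (simp_all add: algebra_simps)
lemma eval_int_poly_1 [simp]: "eval_int_poly x 1 = 1" by (simp add: eval_int_poly_def)
lemma eval_int_poly_power [simp]: "eval_int_poly x (f ^ n) = eval_int_poly x f ^ n" by (induction n) auto
lemma eval_int_poly_sum [simp]: "eval_int_poly x (sum f K) = (\<Sum>k\<in>K. eval_int_poly x (f k))"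
  by (induction K rule: infinite_finite_induct) auto
lemma eval_int_poly_diff [simp]: "eval_int_poly x (f - g) = eval_int_poly x f - eval_int_poly x g"
  using eval_int_poly_add[of x "f - g" g] by simp

definition Zsqrt3 :: "real set" where "Zsqrt3 = {of_int u + of_int v * sqrt 3 | u v. True}"

lemma Zsqrt3I: "of_int u + of_int v * sqrt 3 \<in> Zsqrt3" by (auto simp: Zsqrt3_def)
lemma Zsqrt3_of_int [simp]: "of_int u \<in> Zsqrt3" using Zsqrt3I[of u 0] by simp
lemma Zsqrt3_add: "a \<in> Zsqrt3 \<Longrightarrow> b \<in> Zsqrt3 \<Longrightarrow> a + b \<in> Zsqrt3"
proof (clarsimp simp: Zsqrt3_def)
  fix u v u' v'
  show "\<exists>w z. real_of_int u + real_of_int v * sqrt 3 + (real_of_int u' + real_of_int v' * sqrt 3) = real_of_int w + real_of_int z * sqrt 3"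
    by (rule exI[of _ "u + u'"], rule exI[of _ "v + v'"]) (simp add: algebra_simps)
qed
lemma Zsqrt3_mult: "a \<in> Zsqrt3 \<Longrightarrow> b \<in> Zsqrt3 \<Longrightarrow> a * b \<in> Zsqrt3"
proof (clarsimp simp: Zsqrt3_def)
  fix u v u' v'
  show "\<exists>w z. (real_of_int u + real_of_int v * sqrt 3) * (real_of_int u' + real_of_int v' * sqrt 3) = real_of_int w + real_of_int z * sqrt 3"
    by (rule exI[of _ "u * u' + 3 * v * v'"], rule exI[of _ "u * v' + v * u'"]) (simp add: algebra_simps)
qed
lemma Zsqrt3_power: "a \<in> Zsqrt3 \<Longrightarrow> a ^ n \<in> Zsqrt3"
  using Zsqrt3_of_int[of 1] by (induction n) (auto intro: Zsqrt3_mult)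

text \<open>
  The exponent of \<open>3\<close> is even on the left and odd on the right.
\<close>
lemma sqrt3_irrational: "u\<^sup>2 = 3 * v\<^sup>2 \<Longrightarrow> v = (0 :: int)"
proof (rule ccontr)
  assume eq: "u\<^sup>2 = 3 * v\<^sup>2" and v: "v \<noteq> 0"
  hence "u \<noteq> 0" by auto
  have "prime (3 :: int)" by simp
  have "multiplicity 3 (u\<^sup>2) = 2 * multiplicity (3::int) u"
    using \<open>u \<noteq> 0\<close> by (simp add: prime_elem_multiplicity_power_distrib)
  moreover have "multiplicity 3 (3 * v\<^sup>2) = 1 + 2 * multiplicity (3::int) v"
    using v by (simp add: prime_elem_multiplicity_mult_distrib prime_elem_multiplicity_power_distrib)
  ultimately have "2 * multiplicity (3::int) u = 1 + 2 * multiplicity (3::int) v" using eq by simp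
  thus False by presburger
qed

text \<open>
  Divisibility of an integer by \<open>p\<close> in \<open>\<int>[sqrt 3]\<close> descends to \<open>\<int>\<close>.
\<close>
lemma Zsqrt3_dvd:
  assumes "of_int i = of_int p * a" "a \<in> Zsqrt3" "p \<noteq> 0"
  shows "p dvd i"
proof -
  obtain u v where a: "a = of_int u + of_int v * sqrt 3" using assms(2) by (auto simp: Zsqrt3_def)
  have "real_of_int (i - p * u) = of_int (p * v) * sqrt 3"
    using assms(1) by (simp add: a algebra_simps)
  hence "(real_of_int (i - p * u))\<^sup>2 = (of_int (p * v) * sqrt 3)\<^sup>2" by (simp only:)
  also have "\<dots> = 3 * (of_int (p * v))\<^sup>2" by (simp add: power_mult_distrib)
  finally have "real_of_int ((i - p * u)\<^sup>2) = of_int (3 * (p * v)\<^sup>2)" by simp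
  hence eq: "(i - p * u)\<^sup>2 = 3 * (p * v)\<^sup>2" by (simp only: of_int_eq_iff)
  hence "p * v = 0" by (rule sqrt3_irrational)
  hence "(i - p * u)\<^sup>2 = 0" unfolding eq by simp
  hence "i = p * u" by simp
  thus ?thesis by simp
qed

text \<open>
  A solution of \<open>50 z a = e^2\<close>. With \<open>t = 2 - sqrt 3\<close>, a unit, it satisfies \<open>e = 15 t^2\<close>,
  \<open>1 - 2z = 3t\<close> and \<open>54 z^2 = (3t)^3\<close>.
\<close>
definition z0 :: real where "z0 = (3 * sqrt 3 - 5) / 2"

lemma eval_z0_Zsqrt3: "\<exists>N. 2 ^ N * eval_int_poly z0 f \<in> Zsqrt3"
proof (induction f)
  case (pCons c f)
  then obtain N where N: "2 ^ N * eval_int_poly z0 f \<in> Zsqrt3" by blast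
  have "2 * z0 = of_int (-5) + of_int 3 * sqrt 3" by (simp add: z0_def field_simps)
  hence z: "2 * z0 \<in> Zsqrt3" by (simp only: Zsqrt3I)
  have "of_int (2 ^ Suc N * c) + 2 * z0 * (2 ^ N * eval_int_poly z0 f) \<in> Zsqrt3"
    by (rule Zsqrt3_add[OF Zsqrt3_of_int Zsqrt3_mult[OF z N]])
  hence "2 ^ Suc N * eval_int_poly z0 (pCons c f) \<in> Zsqrt3" by (simp add: algebra_simps)
  thus ?case by blast
qed (use Zsqrt3_of_int[of 0] in auto)

text \<open>
  If \<open>g / y^d = 1/c\<close>, a weighted homogeneous sum in \<open>g\<close> and \<open>y\<close> becomes a sum over powers
  of \<open>1/c\<close>.
\<close>
lemma sum_power_rescale:
  fixes a :: "nat \<Rightarrow> real" and c g y :: real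
  assumes "c * g = y ^ d" and K: "\<And>k. k \<in> K \<Longrightarrow> k \<le> N \<and> d * k \<le> N"
  shows "c ^ N * (\<Sum>k\<in>K. a k * (g ^ k * y ^ (N - d * k))) = y ^ N * (\<Sum>k\<in>K. a k * c ^ (N - k))"
  unfolding sum_distrib_left
proof (rule sum.cong)
  fix k assume k: "k \<in> K"
  have "c ^ N = c ^ (N - k) * c ^ k" using K[OF k] by (simp flip: power_add)
  hence "c ^ N * (a k * (g ^ k * y ^ (N - d * k))) = a k * c ^ (N - k) * ((c * g) ^ k * y ^ (N - d * k))"
    by (simp only: power_mult_distrib ac_simps)
  also have "(c * g) ^ k * y ^ (N - d * k) = y ^ (d * k + (N - d * k))"
    unfolding assms(1) by (simp only: power_add power_mult)
  also have "d * k + (N - d * k) = N" using K[OF k] by simp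
  finally show "c ^ N * (a k * (g ^ k * y ^ (N - d * k))) = y ^ N * (a k * c ^ (N - k))"
    by (simp only: ac_simps)
qed simp

lemma fermat_cong_mult:
  assumes "prime p" "\<not> p dvd a"
  shows "[int a ^ (p - 1) * x = x] (mod int p)"
  using cong_mult[OF fermat_int[OF assms] cong_refl[of x]] by simp

text \<open>
  The polynomial congruence is evaluated at \<^const>\<open>z0\<close>. The two sides carry the factors \<open>(15 t^2)^(p - 1)\<close>
  and \<open>(3t)^(2(p - 1))\<close>: the powers of the unit \<open>t\<close> cancel, and the integer factors are \<open>1\<close> modulo
  \<open>p\<close> by Fermat's theorem.
\<close>
theorem central_franel_sum_cong_square:
  assumes p: "prime p" "p > 5"
  defines "S \<equiv> (\<Sum>k | 2 * k < p. central_franel k * 50 ^ (p - 1 - k))"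
  defines "L \<equiv> (\<Sum>k | 3 * k < p. multinom3 k * 54 ^ (p - 1 - k))"
  shows "[S = L\<^sup>2] (mod int p)"
proof -
  define t E where "t = 2 - sqrt 3" and "E = 2 + sqrt 3"
  have tE: "t * E = 1" by (simp add: t_def E_def algebra_simps)
  \<comment> \<open>The coordinates of the special point; they yield \<open>1/50\<close> and \<open>1/54\<close> as arguments.\<close>
  have e: "1 + 8 * z0\<^sup>2 = 15 * t\<^sup>2"
    by (simp add: z0_def t_def power2_eq_square field_simps)
  have za: "50 * (z0 - 7 * z0\<^sup>2 - 8 * z0 ^ 3) = (15 * t\<^sup>2)\<^sup>2"
    by (simp add: z0_def t_def power_numeral_reduce field_simps)
  have d: "1 - 2 * z0 = 3 * t" by (simp add: z0_def t_def field_simps)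
  have zz: "54 * z0\<^sup>2 = (3 * t) ^ 3"
    by (simp add: z0_def t_def power_numeral_reduce field_simps)
  have odd: "odd p" using p prime_odd_nat by auto
  obtain R where R: "clausen_poly p - (cubic_poly p)\<^sup>2 = [:int p:] * R"
    using clausen_poly_cong_cubic_poly_squared[OF p(1) odd] by blast
  define n where "n = p - 1"
  have A: "50 ^ n * eval_int_poly z0 (clausen_poly p) = (15 * t\<^sup>2) ^ n * of_int S"
  proof -
    have "eval_int_poly z0 [:0, 1, -7, -8:] = z0 - 7 * z0\<^sup>2 - 8 * z0 ^ 3" "eval_int_poly z0 [:1, 0, 8:] = 15 * t\<^sup>2"
      unfolding e[symmetric] by (simp_all add: power_numeral_reduce algebra_simps)
    hence "eval_int_poly z0 (clausen_poly p) = (\<Sum>k | 2 * k < p. of_int (central_franel k) * ((z0 - 7 * z0\<^sup>2 - 8 * z0 ^ 3) ^ k * (15 * t\<^sup>2) ^ (n - 2 * k)))"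
      by (simp add: clausen_poly_def n_def del: eval_int_poly_pCons)
    hence "50 ^ n * eval_int_poly z0 (clausen_poly p) = (15 * t\<^sup>2) ^ n * (\<Sum>k | 2 * k < p. of_int (central_franel k) * 50 ^ (n - k))"
      by (simp only:) (rule sum_power_rescale[OF za], auto simp: n_def)
    thus ?thesis by (simp add: S_def n_def)
  qed
  have Q: "54 ^ n * eval_int_poly z0 (cubic_poly p) = (3 * t) ^ n * of_int L"
  proof -
    have "eval_int_poly z0 [:0, 0, 1:] = z0\<^sup>2" "eval_int_poly z0 [:1, -2:] = 3 * t"
      unfolding d[symmetric] by (simp_all add: power_numeral_reduce algebra_simps)
    hence "eval_int_poly z0 (cubic_poly p) = (\<Sum>k | 3 * k < p. of_int (multinom3 k) * ((z0\<^sup>2) ^ k * (3 * t) ^ (n - 3 * k)))"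
      by (simp add: cubic_poly_def n_def del: eval_int_poly_pCons)
    hence "54 ^ n * eval_int_poly z0 (cubic_poly p) = (3 * t) ^ n * (\<Sum>k | 3 * k < p. of_int (multinom3 k) * 54 ^ (n - k))"
      by (simp only:) (rule sum_power_rescale[OF zz], auto simp: n_def)
    thus ?thesis by (simp add: L_def n_def)
  qed
  have "eval_int_poly z0 (clausen_poly p - (cubic_poly p)\<^sup>2) = of_int (int p) * eval_int_poly z0 R"
    unfolding R by simp
  hence R': "eval_int_poly z0 (clausen_poly p) - (eval_int_poly z0 (cubic_poly p))\<^sup>2 = of_int (int p) * eval_int_poly z0 R" by simp
  have E1: "E ^ (2 * n) * (15 * t\<^sup>2) ^ n = 15 ^ n"
  proof -
    have "E ^ (2 * n) * (15 * t\<^sup>2) ^ n = (E\<^sup>2 * (15 * t\<^sup>2)) ^ n"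
      by (simp only: power_mult power_mult_distrib)
    also have "E\<^sup>2 * (15 * t\<^sup>2) = 15 * (t * E)\<^sup>2"
      by (simp only: power_mult_distrib ac_simps)
    finally show ?thesis by (simp add: tE)
  qed
  have E2: "E ^ (2 * n) * ((3 * t) ^ n)\<^sup>2 = 9 ^ n"
  proof -
    have "E ^ (2 * n) * ((3 * t) ^ n)\<^sup>2 = (E\<^sup>2 * (3 * t)\<^sup>2) ^ n"
      by (simp only: power_mult power_mult_distrib power_even_eq[symmetric] mult.commute[of n 2] power_mult[symmetric, of _ n 2])
    also have "E\<^sup>2 * (3 * t)\<^sup>2 = 9 * (t * E)\<^sup>2"
      by (simp add: power_mult_distrib)
    finally show ?thesis by (simp add: tE)
  qed
  have X: "15 ^ n * 54 ^ n * 54 ^ n * of_int S - 9 ^ n * 50 ^ n * of_int (L\<^sup>2)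
      = of_int (int p) * (50 ^ n * 54 ^ n * 54 ^ n * E ^ (2 * n) * eval_int_poly z0 R)"
  proof -
    have "of_int (int p) * (50 ^ n * 54 ^ n * 54 ^ n * E ^ (2 * n) * eval_int_poly z0 R)
        = 50 ^ n * 54 ^ n * 54 ^ n * E ^ (2 * n) * (eval_int_poly z0 (clausen_poly p) - (eval_int_poly z0 (cubic_poly p))\<^sup>2)"
      unfolding R' by (simp only: ac_simps)
    also have "\<dots> = 54 ^ n * 54 ^ n * E ^ (2 * n) * (50 ^ n * eval_int_poly z0 (clausen_poly p))
        - 50 ^ n * E ^ (2 * n) * (54 ^ n * eval_int_poly z0 (cubic_poly p))\<^sup>2"
      by (simp only: power2_eq_square right_diff_distrib ac_simps)
    also have "\<dots> = (E ^ (2 * n) * (15 * t\<^sup>2) ^ n) * (54 ^ n * 54 ^ n * of_int S)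
        - (E ^ (2 * n) * ((3 * t) ^ n)\<^sup>2) * (50 ^ n * (of_int L)\<^sup>2)"
      unfolding A Q by (simp only: power_mult_distrib ac_simps)
    finally show ?thesis unfolding E1 E2 by (simp only: of_int_power ac_simps)
  qed
  \<comment> \<open>The point has denominator \<open>2\<close>, so a power of \<open>2\<close> is needed to land in \<open>\<int>[sqrt 3]\<close>.\<close>
  obtain N where N: "2 ^ N * eval_int_poly z0 R \<in> Zsqrt3" using eval_z0_Zsqrt3 by blast
  define I where "I = 15 ^ (p - 1) * (54 ^ (p - 1) * (54 ^ (p - 1) * S)) - 9 ^ (p - 1) * (50 ^ (p - 1) * L\<^sup>2)"
  have "real_of_int (2 ^ N * I) = 2 ^ N * (15 ^ n * 54 ^ n * 54 ^ n * of_int S - 9 ^ n * 50 ^ n * of_int (L\<^sup>2))"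
    by (simp add: I_def n_def algebra_simps)
  hence "of_int (2 ^ N * I) = of_int (int p) * (of_int (50 ^ n * 54 ^ n * 54 ^ n) * E ^ (2 * n) * (2 ^ N * eval_int_poly z0 R))"
    unfolding X by (simp add: algebra_simps)
  moreover have "E \<in> Zsqrt3" using Zsqrt3I[of 2 1] by (simp add: E_def)
  hence "of_int (50 ^ n * 54 ^ n * 54 ^ n) * E ^ (2 * n) * (2 ^ N * eval_int_poly z0 R) \<in> Zsqrt3"
    by (intro Zsqrt3_mult[OF Zsqrt3_mult[OF Zsqrt3_of_int Zsqrt3_power] N])
  ultimately have "int p dvd 2 ^ N * I"
    using p(2) by (intro Zsqrt3_dvd) auto
  moreover have "coprime (int p) (2 ^ N)" using odd by simp
  ultimately have "int p dvd I" by (simp add: coprime_dvd_mult_right_iff)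
  have nd: "\<not> p dvd 15" "\<not> p dvd 54" "\<not> p dvd 9" "\<not> p dvd 50"
  proof -
    have q: "\<not> p dvd 2" "\<not> p dvd 3" "\<not> p dvd 5" using p by (auto dest!: dvd_imp_le)
    have "\<not> p dvd 3 * 5" "\<not> p dvd 2 * (3 * (3 * 3))" "\<not> p dvd 3 * 3" "\<not> p dvd 2 * (5 * 5)"
      using q p(1) by (simp_all only: prime_dvd_mult_iff not_False_eq_True disj_not1 simp_thms)
    thus "\<not> p dvd 15" "\<not> p dvd 54" "\<not> p dvd 9" "\<not> p dvd 50" by simp_all
  qed
  have "[15 ^ (p - 1) * (54 ^ (p - 1) * (54 ^ (p - 1) * S)) = 54 ^ (p - 1) * (54 ^ (p - 1) * S)] (mod int p)"
    using fermat_cong_mult[OF p(1) nd(1)] by (simp only: of_nat_numeral)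
  also have "[54 ^ (p - 1) * (54 ^ (p - 1) * S) = 54 ^ (p - 1) * S] (mod int p)"
    using fermat_cong_mult[OF p(1) nd(2)] by (simp only: of_nat_numeral)
  also have "[54 ^ (p - 1) * S = S] (mod int p)"
    using fermat_cong_mult[OF p(1) nd(2)] by (simp only: of_nat_numeral)
  finally have "[S = 15 ^ (p - 1) * (54 ^ (p - 1) * (54 ^ (p - 1) * S))] (mod int p)"
    by (rule cong_sym)
  also have "[15 ^ (p - 1) * (54 ^ (p - 1) * (54 ^ (p - 1) * S)) = 9 ^ (p - 1) * (50 ^ (p - 1) * L\<^sup>2)] (mod int p)"
    using \<open>int p dvd I\<close> by (simp only: I_def cong_iff_dvd_diff)
  also have "[9 ^ (p - 1) * (50 ^ (p - 1) * L\<^sup>2) = 50 ^ (p - 1) * L\<^sup>2] (mod int p)"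
    using fermat_cong_mult[OF p(1) nd(3)] by (simp only: of_nat_numeral)
  also have "[50 ^ (p - 1) * L\<^sup>2 = L\<^sup>2] (mod int p)"
    using fermat_cong_mult[OF p(1) nd(4)] by (simp only: of_nat_numeral)
  finally show ?thesis .
qed

section \<open>The hypergeometric sum as a Legendre polynomial at 0\<close>

lemma coeff_one_plus_x_power: "coeff ([:1, 1 :: int:] ^ n) k = int (n choose k)"
proof (cases "k \<le> n")
  case False
  have "degree ([:1, 1 :: int:] ^ n) \<le> n" by (simp add: degree_power_eq)
  thus ?thesis using False by (simp add: coeff_eq_0 binomial_eq_0)
qed (simp add: coeff_linear_poly_power)

text \<open>
  The left-hand side is \<open>2^m\<close> times the Legendre polynomial of degree \<open>m\<close> at \<open>0\<close>. The identity is obtained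
  by expanding the first factor of \<open>x^2 - 1 = (2x - (1 + x)) (1 + x)\<close>.
\<close>
lemma legendre_at_0_sum:
  "(\<Sum>k\<le>m. (-1) ^ k * int ((m choose k) * (m + k choose k)) * 2 ^ (m - k)) = coeff ([:-1, 0, 1:] ^ m) m"
proof -
  define q where "q = [:1, 1 :: int:]"
  have "[:-1, 0, 1 :: int:] = (smult (-1) q + [:0, 2:]) * q" by (simp add: q_def)
  hence "[:-1, 0, 1 :: int:] ^ m = (\<Sum>k\<le>m. of_nat (m choose k) * smult (-1) q ^ k * [:0, 2:] ^ (m - k)) * q ^ m"
    by (simp only: power_mult_distrib binomial_ring)
  also have "\<dots> = (\<Sum>k\<le>m. smult ((-1) ^ k * int (m choose k) * 2 ^ (m - k)) (monom 1 (m - k) * q ^ (m + k)))"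
    unfolding sum_distrib_right
  proof (rule sum.cong)
    fix k
    have "[:0, 2 :: int:] = smult 2 (monom 1 1)" by (simp add: monom_Suc)
    hence "[:0, 2 :: int:] ^ (m - k) = smult (2 ^ (m - k)) (monom 1 (m - k))"
      by (simp add: smult_power monom_power)
    moreover have "smult (-1) q ^ k = smult ((-1) ^ k) (q ^ k)"
      by (simp only: smult_power)
    ultimately show "of_nat (m choose k) * smult (-1) q ^ k * [:0, 2:] ^ (m - k) * q ^ m =
        smult ((-1) ^ k * int (m choose k) * 2 ^ (m - k)) (monom 1 (m - k) * q ^ (m + k))"
      by (simp only:) (simp add: power_add of_nat_poly algebra_simps)
  qed simp
  also have "coeff \<dots> m = (\<Sum>k\<le>m. (-1) ^ k * int ((m choose k) * (m + k choose k)) * 2 ^ (m - k))"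
    unfolding coeff_sum
    by (rule sum.cong) (auto simp: coeff_monom_mult coeff_one_plus_x_power q_def)
  finally show ?thesis by simp
qed

lemma coeff_x2_minus_1_power:
  "coeff ([:-1, 0, 1 :: int:] ^ m) m = (if odd m then 0 else (-1) ^ (m div 2) * int (m choose (m div 2)))"
proof -
  have "[:-1, 0, 1 :: int:] = [:-1:] + monom 1 2" by (simp add: numeral_2_eq_2 monom_Suc)
  hence "[:-1, 0, 1 :: int:] ^ m = (\<Sum>k\<le>m. of_nat (m choose k) * [:-1:] ^ k * monom 1 2 ^ (m - k))"
    by (simp only: binomial_ring)
  also have "\<dots> = (\<Sum>k\<le>m. smult (int (m choose k) * (-1) ^ k) (monom 1 (2 * (m - k))))"
    by (rule sum.cong) (auto simp: monom_power of_nat_poly poly_const_pow mult.commute)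
  also have "coeff \<dots> m = (\<Sum>k\<le>m. if m = 2 * k then int (m choose k) * (-1) ^ k else 0)"
    unfolding coeff_sum by (rule sum.cong) (auto simp: coeff_monom)
  also have "\<dots> = (if odd m then 0 else (-1) ^ (m div 2) * int (m choose (m div 2)))"
  proof (cases "odd m")
    case False
    then obtain n where n: "m = 2 * n" by (auto elim: evenE)
    have "(\<Sum>k\<le>m. if m = 2 * k then int (m choose k) * (-1) ^ k else 0) = (\<Sum>k\<in>{n}. int (m choose k) * (-1) ^ k)"
      by (rule sum.mono_neutral_cong_right) (auto simp: n)
    thus ?thesis by (simp add: n)
  qed (auto intro!: sum.neutral)
  finally show ?thesis .
qed

lemma Suc_times_choose_Suc: "(int k + 1) * int (m choose Suc k) = (int m - int k) * int (m choose k)"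
proof (cases "k \<le> m")
  case True
  have "Suc k * (m choose Suc k) = (m - k) * (m choose k)"
    by (simp only: binomial_absorption binomial_absorb_comp)
  hence "int (Suc k * (m choose Suc k)) = int ((m - k) * (m choose k))" by (simp only:)
  thus ?thesis by (simp only: of_nat_mult of_nat_diff[OF True] of_nat_Suc add.commute)
qed (simp add: binomial_eq_0)

lemma shifted_binomial_recurrence:
  "(int k + 1)\<^sup>2 * int ((m choose Suc k) * (m + Suc k choose Suc k)) = (int m - int k) * (int m + int k + 1) * int ((m choose k) * (m + k choose k))"
proof -
  note 1 = Suc_times_choose_Suc[of k m]
  have 2: "(int k + 1) * int (m + Suc k choose Suc k) = (int m + int k + 1) * int (m + k choose k)"
    using Suc_times_binomial_eq[of "m + k" k] by (simp del: binomial_Suc_Suc add: algebra_simps flip: of_nat_mult of_nat_Suc)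
  have "(int k + 1)\<^sup>2 * int ((m choose Suc k) * (m + Suc k choose Suc k)) =
     ((int k + 1) * int (m choose Suc k)) * ((int k + 1) * int (m + Suc k choose Suc k))"
    by (simp only: power2_eq_square of_nat_mult ac_simps)
  thus ?thesis unfolding 1 2 by (simp only: of_nat_mult ac_simps)
qed

text \<open>
  Both sides satisfy a recurrence of first order in \<open>k\<close>. The ratios agree modulo \<open>p\<close> because
  \<open>(3m + 1)(3m + 2)\<close> is divisible by \<open>p\<close>.
\<close>
lemma multinom3_cong:
  assumes "prime p" "p = 3 * m + 1 \<or> p = 3 * m + 2" "k < p"
  shows "[multinom3 k = (-27) ^ k * int ((m choose k) * (m + k choose k))] (mod int p)"
  using assms(3)
proof (induction k)
  case (Suc k)
  define b where "b j = int ((m choose j) * (m + j choose j))" for j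
  have key: "[(3 * int k + 1) * (3 * int k + 2) = - 9 * ((int m - int k) * (int m + int k + 1))] (mod int p)"
  proof -
    have "(3 * int k + 1) * (3 * int k + 2) - - 9 * ((int m - int k) * (int m + int k + 1)) = (3 * int m + 1) * (3 * int m + 2)"
      by (simp add: algebra_simps)
    also have "int p dvd \<dots>"
      using assms(2) by (elim disjE) (simp_all only: of_nat_add of_nat_mult of_nat_numeral of_nat_1 dvd_triv_left dvd_triv_right)
    finally show ?thesis by (simp add: cong_iff_dvd_diff)
  qed
  have "(int k + 1)\<^sup>2 * multinom3 (Suc k) = 3 * ((3 * int k + 1) * (3 * int k + 2)) * multinom3 k"
    using multinom3_recurrence[of k] by simp
  also have "[\<dots> = 3 * (- 9 * ((int m - int k) * (int m + int k + 1))) * ((-27) ^ k * b k)] (mod int p)"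
    using Suc unfolding b_def by (intro cong_mult cong_refl key) auto
  also have "3 * (- 9 * ((int m - int k) * (int m + int k + 1))) * ((-27) ^ k * b k) = (-27) ^ Suc k * ((int k + 1)\<^sup>2 * b (Suc k))"
    unfolding b_def shifted_binomial_recurrence by simp
  also have "\<dots> = (int k + 1)\<^sup>2 * ((-27) ^ Suc k * b (Suc k))" by (simp only: ac_simps)
  finally have "[(int k + 1)\<^sup>2 * multinom3 (Suc k) = (int k + 1)\<^sup>2 * ((-27) ^ Suc k * b (Suc k))] (mod int p)" .
  moreover have "coprime ((int k + 1)\<^sup>2) (int p)"
    using coprime_Suc_prime[OF assms(1) Suc.prems] by simp
  ultimately have "[multinom3 (Suc k) = (-27) ^ Suc k * b (Suc k)] (mod int p)"
    by (simp only: cong_mult_lcancel)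
  thus ?case by (simp only: b_def)
qed (simp add: multinom3_def)
lemma multinom3_sum_cong:
  assumes p: "prime p" "p > 5" and m: "p = 3 * m + 1 \<or> p = 3 * m + 2"
  shows "[2 ^ m * (\<Sum>k | 3 * k < p. multinom3 k * 54 ^ (p - 1 - k)) = coeff ([:-1, 0, 1:] ^ m) m] (mod int p)"
proof -
  define b where "b j = int ((m choose j) * (m + j choose j))" for j
  have K: "{k. 3 * k < p} = {..m}" using m by auto
  have nd: "\<not> p dvd 2" "\<not> p dvd 27"
  proof -
    show "\<not> p dvd 2" using p by (auto dest!: dvd_imp_le)
    have "\<not> p dvd 3" using p by (auto dest!: dvd_imp_le)
    moreover have "(27::nat) = 3 ^ 3" by simp
    ultimately show "\<not> p dvd 27" using p(1) by (metis prime_dvd_power)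
  qed
  have "2 ^ m * (\<Sum>k\<le>m. multinom3 k * 54 ^ (p - 1 - k)) = (\<Sum>k\<le>m. 2 ^ m * (multinom3 k * 54 ^ (p - 1 - k)))"
    by (simp add: sum_distrib_left)
  also have "[\<dots> = (\<Sum>k\<le>m. 2 ^ m * (((-27) ^ k * b k) * 54 ^ (p - 1 - k)))] (mod int p)"
    unfolding b_def by (intro cong_sum cong_mult cong_refl multinom3_cong[OF p(1) m]) (use m in auto)
  also have "(\<Sum>k\<le>m. 2 ^ m * (((-27) ^ k * b k) * 54 ^ (p - 1 - k)))
     = (\<Sum>k\<le>m. 27 ^ (p - 1) * (2 ^ (p - 1) * ((-1) ^ k * b k * 2 ^ (m - k))))"
  proof (rule sum.cong)
    fix k assume k: "k \<in> {..m}"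
    have "(54::int) ^ (p - 1 - k) = 27 ^ (p - 1 - k) * 2 ^ (p - 1 - k)" by (simp flip: power_mult_distrib)
    moreover have "(-27 :: int) ^ k = (-1) ^ k * 27 ^ k" by (simp flip: power_mult_distrib)
    ultimately have "2 ^ m * (((-27) ^ k * b k) * 54 ^ (p - 1 - k)) =
       (27 ^ k * 27 ^ (p - 1 - k)) * ((2 ^ m * 2 ^ (p - 1 - k)) * ((-1) ^ k * b k))"
      by (simp only: ac_simps)
    also have "(27 ^ k * 27 ^ (p - 1 - k) :: int) = 27 ^ (p - 1)"
      using k m by (auto simp flip: power_add)
    also have "(2 ^ m * 2 ^ (p - 1 - k) :: int) = 2 ^ (p - 1) * 2 ^ (m - k)"
      using k m by (auto simp flip: power_add)
    finally show "2 ^ m * (((-27) ^ k * b k) * 54 ^ (p - 1 - k)) = 27 ^ (p - 1) * (2 ^ (p - 1) * ((-1) ^ k * b k * 2 ^ (m - k)))"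
      by (simp only: ac_simps)
  qed simp
  also have "[\<dots> = (\<Sum>k\<le>m. (-1) ^ k * b k * 2 ^ (m - k))] (mod int p)"
  proof (rule cong_sum)
    fix k
    have "[27 ^ (p - 1) * (2 ^ (p - 1) * ((-1) ^ k * b k * 2 ^ (m - k))) = 2 ^ (p - 1) * ((-1) ^ k * b k * 2 ^ (m - k))] (mod int p)"
      using fermat_cong_mult[OF p(1) nd(2)] by (simp only: of_nat_numeral)
    also have "[2 ^ (p - 1) * ((-1) ^ k * b k * 2 ^ (m - k)) = (-1) ^ k * b k * 2 ^ (m - k)] (mod int p)"
      using fermat_cong_mult[OF p(1) nd(1)] by (simp only: of_nat_numeral)
    finally show "[27 ^ (p - 1) * (2 ^ (p - 1) * ((-1) ^ k * b k * 2 ^ (m - k))) = (-1) ^ k * b k * 2 ^ (m - k)] (mod int p)" .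
  qed
  finally show ?thesis unfolding K legendre_at_0_sum[symmetric] b_def .
qed

text \<open>
  Modulo \<open>p\<close>, \<open>h\<close> is \<open>-1/2\<close>, and \<open>(-4)^k (-1/2 choose k) = (2k choose k)\<close>.
\<close>
lemma half_binomial_cong:
  assumes p: "prime p" "p = 2 * h + 1" and "k < p"
  shows "[(-4) ^ k * int (h choose k) = int (2 * k choose k)] (mod int p)"
  using assms(3)
proof (induction k)
  case (Suc k)
  note 1 = Suc_times_choose_Suc[of k h]
  have 2: "(int k + 1) * int (2 * Suc k choose Suc k) = 2 * (2 * int k + 1) * int (2 * k choose k)"
    using arg_cong[OF central_binomial_Suc[of k], of int] by (simp only: of_nat_mult of_nat_add of_nat_1 of_nat_numeral Suc_eq_plus1)
  have "(int k + 1) * ((-4) ^ Suc k * int (h choose Suc k)) = (-4) ^ Suc k * ((int k + 1) * int (h choose Suc k))"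
    by (simp only: ac_simps)
  also have "\<dots> = - 4 * (int h - int k) * ((-4) ^ k * int (h choose k))"
    unfolding 1 by (simp add: algebra_simps)
  also have "[\<dots> = 2 * (2 * int k + 1) * int (2 * k choose k)] (mod int p)"
  proof (rule cong_mult)
    have "- 4 * (int h - int k) - 2 * (2 * int k + 1) = int p * -2" using p by simp
    thus "[- 4 * (int h - int k) = 2 * (2 * int k + 1)] (mod int p)" by (simp only: cong_iff_dvd_diff dvd_triv_left)
    show "[(-4) ^ k * int (h choose k) = int (2 * k choose k)] (mod int p)" using Suc by simp
  qed
  finally have "[(int k + 1) * ((-4) ^ Suc k * int (h choose Suc k)) = (int k + 1) * int (2 * Suc k choose Suc k)] (mod int p)"
    unfolding 2 .
  thus ?case using coprime_Suc_prime[OF p(1) Suc.prems] by (simp only: cong_mult_lcancel)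
qed simp

section \<open>The quadratic character and power sums\<close>

abbreviation Res :: "nat \<Rightarrow> int set" where "Res p \<equiv> {0..<int p}"

definition periodic :: "nat \<Rightarrow> (int \<Rightarrow> 'a) \<Rightarrow> bool" where
  "periodic p f \<longleftrightarrow> (\<forall>a. f (a mod int p) = f a)"

lemma sum_Res_permute:
  fixes f :: "int \<Rightarrow> int"
  assumes "p > 0" and f: "periodic p f" and inj: "\<And>x y. [h x = h y] (mod int p) \<Longrightarrow> [x = y] (mod int p)"
  shows "(\<Sum>x\<in>Res p. f (h x)) = (\<Sum>x\<in>Res p. f x)"
proof -
  let ?h = "\<lambda>x. h x mod int p"
  have "inj_on ?h (Res p)"
  proof (rule inj_onI)
    fix x y assume xy: "x \<in> Res p" "y \<in> Res p" "?h x = ?h y"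
    from xy(3) have "[h x = h y] (mod int p)" by (simp only: cong_def)
    hence "[x = y] (mod int p)" by (rule inj)
    moreover have "0 \<le> x" "x < int p" "0 \<le> y" "y < int p" using xy(1,2) by simp_all
    ultimately show "x = y" by (intro cong_less_imp_eq_int[of x "int p" y])
  qed
  moreover have "?h ` Res p \<subseteq> Res p" using assms(1) by auto
  ultimately have "?h ` Res p = Res p" by (intro endo_inj_surj) auto
  hence "(\<Sum>x\<in>Res p. f x) = (\<Sum>x\<in>Res p. f (?h x))"
    using sum.reindex[OF \<open>inj_on ?h (Res p)\<close>, of f] by simp
  thus ?thesis using f by (simp add: periodic_def)
qed

locale odd_prime =
  fixes p :: nat
  assumes p: "prime p" and p2: "p > 2"
begin

lemma p0: "p > 0" using p2 by simp

lemma int_prime: "prime (int p)" using p by simp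

definition chi :: "int \<Rightarrow> int" where "chi a = Legendre a (int p)"

lemma chi_cases: "chi a = -1 \<or> chi a = 0 \<or> chi a = 1"
  by (auto simp: chi_def Legendre_def)

lemma chi_euler: "[chi a = a ^ ((p - 1) div 2)] (mod int p)"
  unfolding chi_def by (rule euler_criterion[OF p p2])

text \<open>
  Character sums are determined by their residue modulo \<open>p\<close> once they are known to be small.
\<close>
lemma small_cong_eq: "[u = v] (mod int p) \<Longrightarrow> \<bar>u - v\<bar> < int p \<Longrightarrow> u = v"
  by (rule ccontr) (use dvd_imp_le_int[of "u - v" "int p"] in \<open>auto simp: cong_iff_dvd_diff\<close>)

lemma chi_eqI: "[chi a = v] (mod int p) \<Longrightarrow> v = -1 \<or> v = 0 \<or> v = 1 \<Longrightarrow> chi a = v"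
  using chi_cases[of a] p2 by (intro small_cong_eq) auto

lemma chi_cong: "[a = b] (mod int p) \<Longrightarrow> chi a = chi b"
proof (rule chi_eqI[OF _ chi_cases])
  assume "[a = b] (mod int p)"
  hence "[a ^ ((p - 1) div 2) = b ^ ((p - 1) div 2)] (mod int p)" by (rule cong_pow)
  thus "[chi a = chi b] (mod int p)" by (meson chi_euler cong_sym cong_trans)
qed

lemma chi_mult: "chi (a * b) = chi a * chi b"
proof (rule chi_eqI)
  have "[chi (a * b) = a ^ ((p - 1) div 2) * b ^ ((p - 1) div 2)] (mod int p)"
    using chi_euler[of "a * b"] by (simp add: power_mult_distrib)
  moreover have "[chi a * chi b = a ^ ((p - 1) div 2) * b ^ ((p - 1) div 2)] (mod int p)"
    by (intro cong_mult chi_euler)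
  ultimately show "[chi (a * b) = chi a * chi b] (mod int p)" by (metis cong_sym cong_trans)
  show "chi a * chi b = -1 \<or> chi a * chi b = 0 \<or> chi a * chi b = 1"
    using chi_cases[of a] chi_cases[of b] by auto
qed

lemma chi_eq_0_iff: "chi a = 0 \<longleftrightarrow> int p dvd a"
  by (auto simp: chi_def Legendre_def cong_0_iff)

lemma chi_square: "\<not> int p dvd a \<Longrightarrow> chi a * chi a = 1"
  using chi_cases[of a] chi_eq_0_iff[of a] by auto

lemma chi_1 [simp]: "chi 1 = 1"
  using chi_euler[of 1] by (intro chi_eqI) auto

lemma chi_periodic: "periodic p chi"
  by (auto simp: periodic_def intro!: chi_cong)

lemma chi_cube: "chi (a ^ 3) = chi a"
  using chi_cases[of a] by (auto simp: power3_eq_cube chi_mult)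

lemma primitive_root:
  "\<exists>g :: int. (\<forall>j. [g ^ j = 1] (mod int p) \<longleftrightarrow> (p - 1) dvd j) \<and>
    (\<forall>f :: int \<Rightarrow> int. periodic p f \<longrightarrow> (\<Sum>a\<in>Res p. f a) = f 0 + (\<Sum>i<p - 1. f (g ^ i)))"
proof -
  have p1: "p > 1" using p2 by simp
  obtain g where g: "residue_primroot p g" using prime_primitive_root_exists[OF p1 p] by blast
  have ord: "ord p g = p - 1" using g p by (simp add: residue_primroot_def totient_prime)
  have bij: "bij_betw (\<lambda>i. g ^ i mod p) {..<p - 1} {0<..<p}"
    using residue_primroot_is_generator[OF p1 g] p by (simp add: totient_prime totatives_prime)
  show ?thesis
  proof (intro exI[of _ "int g"] conjI allI impI)
    fix j
    have "[int g ^ j = 1] (mod int p) \<longleftrightarrow> [g ^ j = 1] (mod p)"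
      by (metis cong_int_iff of_nat_1 of_nat_power)
    also have "\<dots> \<longleftrightarrow> (p - 1) dvd j" unfolding ord[symmetric] by (rule ord_divides)
    finally show "[int g ^ j = 1] (mod int p) \<longleftrightarrow> (p - 1) dvd j" .
  next
    fix f :: "int \<Rightarrow> int" assume f: "periodic p f"
    have "Res p = insert 0 (int ` {0<..<p})"
    proof -
      have "{0..<p} = insert 0 {0<..<p}" using p0 by auto
      thus ?thesis using image_int_atLeastLessThan[of 0 p] by simp
    qed
    hence "(\<Sum>a\<in>Res p. f a) = f 0 + (\<Sum>a\<in>int ` {0<..<p}. f a)"
      by (simp only:) (subst sum.insert, auto)
    also have "(\<Sum>a\<in>int ` {0<..<p}. f a) = (\<Sum>a\<in>{0<..<p}. f (int a))"
      by (subst sum.reindex) (auto simp: inj_on_def)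
    also have "(\<Sum>a\<in>{0<..<p}. f (int a)) = (\<Sum>i<p - 1. f (int (g ^ i mod p)))"
      by (rule sum.reindex_bij_betw[OF bij, symmetric])
    also have "\<dots> = (\<Sum>i<p - 1. f (int g ^ i))"
      using f by (simp add: periodic_def of_nat_mod)
    finally show "(\<Sum>a\<in>Res p. f a) = f 0 + (\<Sum>i<p - 1. f (int g ^ i))" .
  qed
qed

lemma power_sum:
  assumes "j < 2 * (p - 1)"
  shows "[(\<Sum>a\<in>Res p. a ^ j) = (if j = p - 1 then - 1 else 0)] (mod int p)"
proof (cases "j = 0")
  case True
  thus ?thesis using p2 by (simp add: cong_0_iff)
next
  case False
  obtain g :: int where g: "\<And>j. [g ^ j = 1] (mod int p) \<longleftrightarrow> (p - 1) dvd j"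
    and sum: "\<And>f :: int \<Rightarrow> int. periodic p f \<Longrightarrow> (\<Sum>a\<in>Res p. f a) = f 0 + (\<Sum>i<p - 1. f (g ^ i))"
    using primitive_root by blast
  define s where "s = (\<Sum>i<p - 1. (g ^ j) ^ i)"
  have "(\<Sum>a\<in>Res p. a ^ j mod int p) = 0 + (\<Sum>i<p - 1. (g ^ i) ^ j mod int p)"
    using False by (subst sum) (auto simp: periodic_def power_mod zero_power)
  moreover have "[(\<Sum>a\<in>Res p. a ^ j) = (\<Sum>a\<in>Res p. a ^ j mod int p)] (mod int p)"
    by (intro cong_sum) (simp add: cong_def)
  moreover have "[(\<Sum>i<p - 1. (g ^ i) ^ j mod int p) = s] (mod int p)"
    unfolding s_def by (intro cong_sum) (simp add: cong_def mult.commute flip: power_mult)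
  ultimately have S: "[(\<Sum>a\<in>Res p. a ^ j) = s] (mod int p)"
    by (simp only: add_0) (rule cong_trans)
  show ?thesis
  proof (cases "j = p - 1")
    case True
    have "[s = (\<Sum>i<p - 1. 1 ^ i)] (mod int p)"
      unfolding s_def by (intro cong_sum cong_pow) (simp add: g True)
    also have "(\<Sum>i<p - 1. 1 ^ i :: int) = int p - 1" using p0 by simp
    also have "[int p - 1 = - 1] (mod int p)" by (simp add: cong_iff_dvd_diff)
    finally show ?thesis using S True by (auto intro: cong_trans)
  next
    case jp: False
    have "\<not> (p - 1) dvd j"
    proof
      assume "(p - 1) dvd j"
      then obtain c where c: "j = (p - 1) * c" by auto
      hence "(p - 1) * c < (p - 1) * 2" using assms by simp
      hence "c < 2" by (simp only: mult_less_cancel1)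
      thus False using c False jp by (cases "c = 0") (auto simp: less_2_cases_iff)
    qed
    hence "\<not> int p dvd g ^ j - 1" using g[of j] by (simp add: cong_iff_dvd_diff)
    moreover have "(g ^ j - 1) * s = (g ^ j) ^ (p - 1) - 1"
      unfolding s_def by (simp only: power_diff_1_eq)
    moreover have "[(g ^ j) ^ (p - 1) = 1] (mod int p)"
      using g[of "j * (p - 1)"] by (simp add: power_mult)
    ultimately have "int p dvd (g ^ j - 1) * s" "\<not> int p dvd g ^ j - 1"
      by (simp_all add: cong_iff_dvd_diff)
    hence "int p dvd s" using int_prime by (simp add: prime_dvd_mult_iff)
    hence "[s = 0] (mod int p)" by (simp add: cong_0_iff)
    thus ?thesis using S jp by (auto intro: cong_trans)
  qed
qed

text \<open>
  The bound on the degree excludes all multiples of \<open>p - 1\<close> other than \<open>0\<close> and \<open>p - 1\<close> as exponents,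
  and the exponent \<open>0\<close> contributes a multiple of \<open>p\<close>.
\<close>
lemma poly_sum:
  assumes "degree f < 2 * (p - 1)"
  shows "[(\<Sum>a\<in>Res p. poly f a) = - coeff f (p - 1)] (mod int p)"
proof -
  have "(\<Sum>a\<in>Res p. poly f a) = (\<Sum>a\<in>Res p. \<Sum>j<2 * (p - 1). coeff f j * a ^ j)"
  proof (rule sum.cong)
    fix a
    show "poly f a = (\<Sum>j<2 * (p - 1). coeff f j * a ^ j)"
      unfolding poly_altdef by (rule sum.mono_neutral_left) (use assms in \<open>auto simp: coeff_eq_0\<close>)
  qed simp
  also have "\<dots> = (\<Sum>j<2 * (p - 1). coeff f j * (\<Sum>a\<in>Res p. a ^ j))"
    by (subst sum.swap) (simp add: sum_distrib_left)
  also have "[\<dots> = (\<Sum>j<2 * (p - 1). coeff f j * (if j = p - 1 then - 1 else 0))] (mod int p)"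
    by (intro cong_sum cong_mult cong_refl power_sum) simp
  also have "(\<Sum>j<2 * (p - 1). coeff f j * (if j = p - 1 then - 1 else 0)) = (\<Sum>j\<in>{p - 1}. - coeff f j)"
    by (rule sum.mono_neutral_cong_right) (use p2 in auto)
  finally show ?thesis by simp
qed

lemma sum_chi: "(\<Sum>a\<in>Res p. chi a) = 0"
proof -
  define h where "h = (p - 1) div 2"
  have h: "2 * h = p - 1" using p p2 prime_odd_nat[of p] by (auto simp: h_def elim: oddE)
  have "[(\<Sum>a\<in>Res p. chi a) = (\<Sum>a\<in>Res p. poly (monom 1 h) a)] (mod int p)"
    by (intro cong_sum) (simp only: poly_monom mult_1 h_def chi_euler)
  also have "[(\<Sum>a\<in>Res p. poly (monom 1 h) a) = - coeff (monom 1 h) (p - 1)] (mod int p)"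
    by (rule poly_sum) (use h p2 in \<open>simp add: degree_monom_eq\<close>)
  also have "- coeff (monom 1 h) (p - 1) = (0 :: int)" using h p2 by auto
  finally have "[(\<Sum>a\<in>Res p. chi a) = 0] (mod int p)" .
  moreover have "\<bar>\<Sum>a\<in>Res p. chi a\<bar> < int p"
  proof -
    have "(\<Sum>a\<in>Res p. chi a) = (\<Sum>a\<in>Res p - {0}. chi a)"
      by (rule sum.mono_neutral_right) (auto simp: chi_eq_0_iff)
    also have "\<bar>\<dots>\<bar> \<le> (\<Sum>a\<in>Res p - {0}. 1)"
    proof (rule order.trans[OF sum_abs sum_mono])
      fix a show "\<bar>chi a\<bar> \<le> 1" using chi_cases[of a] by auto
    qed
    also have "\<dots> < int p" using p0 by simp
    finally show ?thesis .
  qed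
  ultimately show ?thesis by (intro small_cong_eq) auto
qed

text \<open>
  After a shift only the difference \<open>w\<close> matters. If \<open>p\<close> does not divide it, Euler's criterion replaces
  the summand by the polynomial \<open>a^h (a + w)^h\<close> with leading term \<open>a^(p - 1)\<close>. So the sum is \<open>-1\<close> modulo
  \<open>p\<close>; it has at most \<open>p - 2\<close> nonzero terms and therefore equals \<open>-1\<close>.
\<close>
lemma sum_chi_shift:
  "(\<Sum>a\<in>Res p. chi (a + u) * chi (a + v)) = (if [u = v] (mod int p) then int p - 1 else - 1)"
proof -
  have shift: "(\<Sum>a\<in>Res p. f (a + u)) = (\<Sum>a\<in>Res p. f a)" if "periodic p f" for f :: "int \<Rightarrow> int" and u
    by (rule sum_Res_permute[OF p0 that]) (simp add: cong_add_rcancel)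
  define w where "w = v - u"
  have "(\<Sum>a\<in>Res p. chi (a + u) * chi (a + v)) = (\<Sum>a\<in>Res p. chi (a + u) * chi ((a + u) + w))"
    by (simp add: w_def algebra_simps)
  also have "\<dots> = (\<Sum>a\<in>Res p. chi a * chi (a + w))"
  proof (rule shift)
    have "chi (a mod int p) = chi a" "chi (a mod int p + w) = chi (a + w)" for a
      by (rule chi_cong, simp add: cong_def mod_add_left_eq)+
    thus "periodic p (\<lambda>a. chi a * chi (a + w))" by (simp add: periodic_def)
  qed
  finally have eq: "(\<Sum>a\<in>Res p. chi (a + u) * chi (a + v)) = (\<Sum>a\<in>Res p. chi a * chi (a + w))" .
  show ?thesis
  proof (cases "[u = v] (mod int p)")
    case True
    hence "int p dvd w" unfolding w_def cong_iff_dvd_diff by (subst dvd_diff_commute)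
    hence "chi (a + w) = chi a" for a
      by (intro chi_cong) (simp add: cong_iff_dvd_diff)
    hence "(\<Sum>a\<in>Res p. chi a * chi (a + w)) = (\<Sum>a\<in>Res p. if a = 0 then 0 else 1)"
      using chi_square by (intro sum.cong) (auto simp: chi_eq_0_iff zdvd_not_zless)
    also have "\<dots> = (\<Sum>a\<in>Res p - {0}. 1)" by (rule sum.mono_neutral_cong_right) auto
    also have "\<dots> = int p - 1" using p0 by simp
    finally show ?thesis using eq True by simp
  next
    case False
    hence w: "\<not> int p dvd w" unfolding w_def cong_iff_dvd_diff by (subst dvd_diff_commute)
    define h where "h = (p - 1) div 2"
    have h: "2 * h = p - 1" using p p2 prime_odd_nat[of p] by (auto simp: h_def elim: oddE)
    define f where "f = [:0, 1:] ^ h * [:w, 1:] ^ h"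
    have f: "degree f = p - 1" "coeff f (p - 1) = 1"
    proof -
      show "degree f = p - 1" using h by (simp add: f_def degree_mult_eq degree_power_eq)
      moreover have "lead_coeff f = 1" by (simp add: f_def lead_coeff_mult lead_coeff_power)
      ultimately show "coeff f (p - 1) = 1" by simp
    qed
    have "[(\<Sum>a\<in>Res p. chi a * chi (a + w)) = (\<Sum>a\<in>Res p. poly f a)] (mod int p)"
      using chi_euler by (intro cong_sum) (auto simp: f_def h_def add.commute intro: cong_mult)
    also have "[(\<Sum>a\<in>Res p. poly f a) = - 1] (mod int p)"
      using poly_sum[of f] f p2 by simp
    finally have m1: "[(\<Sum>a\<in>Res p. chi a * chi (a + w)) = - 1] (mod int p)" .
    define c where "c = (- w) mod int p"
    have "c \<noteq> 0"
    proof
      assume "c = 0"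
      hence "int p dvd - w" unfolding c_def by (rule mod_0_imp_dvd)
      thus False using w by simp
    qed
    have "int p > 0" using p0 by simp
    hence c_in: "c \<in> Res p"
      unfolding c_def using pos_mod_bound[of "int p" "- w"] pos_mod_sign[of "int p" "- w"]
      by (intro atLeastLessThan_iff[THEN iffD2] conjI)
    have aw: "chi (c + w) = 0"
    proof -
      have "[c + w = - w + w] (mod int p)" by (intro cong_add cong_refl) (simp add: c_def cong_def)
      thus ?thesis by (simp add: chi_eq_0_iff cong_0_iff)
    qed
    have "(\<Sum>a\<in>Res p. chi a * chi (a + w)) = (\<Sum>a\<in>Res p - {0, c}. chi a * chi (a + w))"
      by (rule sum.mono_neutral_right) (auto simp: chi_eq_0_iff[of 0] aw)
    also have "\<bar>\<dots>\<bar> \<le> (\<Sum>a\<in>Res p - {0, c}. 1)"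
    proof (rule order.trans[OF sum_abs sum_mono])
      fix a show "\<bar>chi a * chi (a + w)\<bar> \<le> 1" using chi_cases[of a] chi_cases[of "a + w"] by auto
    qed
    also have "\<dots> = int p - 2"
      using c_in \<open>c \<noteq> 0\<close> p2 by (simp add: card_Diff_subset)
    finally have "\<bar>\<Sum>a\<in>Res p. chi a * chi (a + w)\<bar> \<le> int p - 2" .
    hence "(\<Sum>a\<in>Res p. chi a * chi (a + w)) = - 1"
      using m1 by (intro small_cong_eq) auto
    thus ?thesis using eq False by simp
  qed
qed

end

section \<open>Character sums of x^3 + a\<close>

locale prime_1_mod_3 = odd_prime +
  fixes q :: nat
  assumes q: "p = 3 * q + 1"
begin

lemma not_dvd_3: "\<not> int p dvd 3"
proof -
  have "int p > 3" using q p2 by (cases q) auto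
  thus ?thesis by (auto dest: zdvd_imp_le)
qed

lemma cube_root_of_unity:
  obtains w :: int where "int p dvd w\<^sup>2 + w + 1"
proof -
  obtain g :: int where g: "\<And>j. [g ^ j = 1] (mod int p) \<longleftrightarrow> (p - 1) dvd j"
    using primitive_root by blast
  have "q > 0" using q p2 by simp
  have "\<not> (p - 1) dvd q" using q \<open>q > 0\<close> by (auto dest: dvd_imp_le)
  hence 1: "\<not> int p dvd g ^ q - 1" using g[of q] by (simp add: cong_iff_dvd_diff)
  have "int p dvd g ^ (3 * q) - 1" using g[of "3 * q"] q by (simp add: cong_iff_dvd_diff)
  also have "g ^ (3 * q) - 1 = (g ^ q - 1) * ((g ^ q)\<^sup>2 + g ^ q + 1)"
    by (simp add: mult.commute[of 3] power_mult) (simp add: power_numeral_reduce algebra_simps)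
  finally show thesis using that[of "g ^ q"] 1 int_prime by (simp add: prime_dvd_mult_iff)
qed

text \<open>
  The three solutions are \<open>y\<close>, \<open>w y\<close> and \<open>w^2 y\<close> for a primitive cube root of unity \<open>w\<close>.
\<close>
lemma card_cube_roots:
  assumes "\<not> int p dvd y"
  shows "card {x \<in> Res p. [x ^ 3 = y ^ 3] (mod int p)} = 3"
proof -
  obtain w where w: "int p dvd w\<^sup>2 + w + 1" by (rule cube_root_of_unity)
  have w1: "\<not> int p dvd w - 1"
  proof
    assume "int p dvd w - 1"
    hence "int p dvd (w\<^sup>2 + w + 1) - (w - 1) * (w + 2)" by (rule dvd_diff[OF w dvd_mult2])
    also have "(w\<^sup>2 + w + 1) - (w - 1) * (w + 2) = 3" by (simp add: power2_eq_square algebra_simps)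
    finally show False using not_dvd_3 by simp
  qed
  have w0: "\<not> int p dvd w"
  proof
    assume "int p dvd w"
    hence "int p dvd (w\<^sup>2 + w + 1) - w * (w + 1)" by (rule dvd_diff[OF w dvd_mult2])
    also have "(w\<^sup>2 + w + 1) - w * (w + 1) = 1" by (simp add: power2_eq_square algebra_simps)
    finally show False using p2 by simp
  qed
  define r where "r c = (c * y) mod int p" for c
  have r: "[r c = c * y] (mod int p)" "0 \<le> r c" "r c < int p" for c
    using p0 by (simp_all add: r_def cong_def)
  have r_eq: "x = r c \<longleftrightarrow> int p dvd x - c * y" if "x \<in> Res p" for x c
  proof
    assume "x = r c" thus "int p dvd x - c * y" using r(1)[of c] by (simp only: cong_iff_dvd_diff)
  next
    assume "int p dvd x - c * y"
    hence "[x = c * y] (mod int p)" by (simp only: cong_iff_dvd_diff)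
    hence "[x = r c] (mod int p)" using r(1)[of c] by (meson cong_sym cong_trans)
    thus "x = r c" using that r(2,3)[of c] by (intro cong_less_imp_eq_int[of x "int p" "r c"]) simp_all
  qed
  have "{x \<in> Res p. [x ^ 3 = y ^ 3] (mod int p)} = {r 1, r w, r (w\<^sup>2)}"
  proof (rule Set.set_eqI)
    fix x
    \<comment> \<open>This is the factorization over the cube roots of unity; the last term collects what \<open>w^2 + w + 1 = 0\<close> removes.\<close>
    have key: "x ^ 3 - y ^ 3 = (x - 1 * y) * ((x - w * y) * (x - w\<^sup>2 * y))
        + (w\<^sup>2 + w + 1) * (x\<^sup>2 * y - w * x * y\<^sup>2 + (w - 1) * y ^ 3)"
      by (simp add: power_numeral_reduce algebra_simps)
    have "int p dvd x ^ 3 - y ^ 3 \<longleftrightarrow> int p dvd (x - 1 * y) * ((x - w * y) * (x - w\<^sup>2 * y))"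
      unfolding key by (rule dvd_add_left_iff) (rule dvd_mult2[OF w])
    hence iff: "[x ^ 3 = y ^ 3] (mod int p) \<longleftrightarrow> int p dvd x - 1 * y \<or> int p dvd x - w * y \<or> int p dvd x - w\<^sup>2 * y"
      using int_prime by (simp only: cong_iff_dvd_diff prime_dvd_mult_iff)
    show "x \<in> {x \<in> Res p. [x ^ 3 = y ^ 3] (mod int p)} \<longleftrightarrow> x \<in> {r 1, r w, r (w\<^sup>2)}"
    proof (cases "x \<in> Res p")
      case True
      thus ?thesis by (simp only: mem_Collect_eq iff insert_iff empty_iff r_eq simp_thms)
    next
      case False
      thus ?thesis using r(2,3)[of 1] r(2,3)[of w] r(2,3)[of "w\<^sup>2"] by auto
    qed
  qed
  moreover have rne: "r c \<noteq> r d" if "\<not> int p dvd c - d" for c d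
  proof
    assume "r c = r d"
    hence "[c * y = d * y] (mod int p)" by (simp only: r_def cong_def)
    hence "int p dvd (c - d) * y" by (simp add: cong_iff_dvd_diff left_diff_distrib)
    thus False using that assms int_prime by (simp add: prime_dvd_mult_iff)
  qed
  have "\<not> int p dvd 1 - w" using w1 by (simp add: dvd_diff_commute)
  moreover have "\<not> int p dvd w - w\<^sup>2"
  proof -
    have "w - w\<^sup>2 = - (w * (w - 1))" by (simp add: power2_eq_square algebra_simps)
    thus ?thesis using w0 w1 int_prime by (simp add: prime_dvd_mult_iff)
  qed
  moreover have "\<not> int p dvd 1 - w\<^sup>2"
  proof
    assume "int p dvd 1 - w\<^sup>2"
    hence "int p dvd (w\<^sup>2 + w + 1) + (1 - w\<^sup>2)" by (intro dvd_add w)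
    hence "int p dvd (w - 1) + 3" by (simp add: algebra_simps)
    hence "int p dvd ((w - 1) + 3) * (w - 1)" by (rule dvd_mult2)
    hence "int p dvd ((w - 1) + 3) * (w - 1) - (w\<^sup>2 + w + 1)" by (intro dvd_diff w)
    also have "((w - 1) + 3) * (w - 1) - (w\<^sup>2 + w + 1) = - 3" by (simp add: power2_eq_square algebra_simps)
    finally show False using not_dvd_3 by simp
  qed
  ultimately show ?thesis by (simp add: rne)
qed

text \<open>
  For \<open>p\<close> not dividing \<open>a\<close>, this is minus the trace of Frobenius of the elliptic curve
  \<open>y^2 = x^3 + a\<close>.
\<close>
definition cubic_char_sum :: "int \<Rightarrow> int" where "cubic_char_sum a = (\<Sum>x\<in>Res p. chi (a + x ^ 3))"

lemma cubic_char_sum_0: "cubic_char_sum 0 = 0"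
  using sum_chi by (simp add: cubic_char_sum_def chi_cube)

lemma cubic_char_sum_periodic: "periodic p cubic_char_sum"
  unfolding periodic_def cubic_char_sum_def
  by (intro allI sum.cong chi_cong refl cong_add cong_refl) (simp add: cong_def)

lemma cubic_char_sum_twist:
  assumes "\<not> int p dvd t"
  shows "cubic_char_sum (a * t ^ 3) = chi t * cubic_char_sum a"
proof -
  have "cubic_char_sum (a * t ^ 3) = (\<Sum>x\<in>Res p. chi (a * t ^ 3 + (t * x) ^ 3))"
    unfolding cubic_char_sum_def
  proof (rule sum_Res_permute[OF p0, symmetric])
    show "periodic p (\<lambda>x. chi (a * t ^ 3 + x ^ 3))"
      unfolding periodic_def by (intro allI chi_cong cong_add cong_refl cong_pow) (simp add: cong_def)
    fix x y assume "[t * x = t * y] (mod int p)"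
    hence "int p dvd t * (x - y)" by (simp add: cong_iff_dvd_diff right_diff_distrib)
    thus "[x = y] (mod int p)" using assms int_prime by (simp add: prime_dvd_mult_iff cong_iff_dvd_diff)
  qed
  also have "\<dots> = (\<Sum>x\<in>Res p. chi (t ^ 3) * chi (a + x ^ 3))"
  proof (rule sum.cong)
    fix x
    have "a * t ^ 3 + (t * x) ^ 3 = t ^ 3 * (a + x ^ 3)" by (simp add: power_mult_distrib algebra_simps)
    thus "chi (a * t ^ 3 + (t * x) ^ 3) = chi (t ^ 3) * chi (a + x ^ 3)" by (simp only: chi_mult)
  qed simp
  finally show ?thesis by (simp add: cubic_char_sum_def chi_cube sum_distrib_left)
qed

lemma first_moment: "(\<Sum>a\<in>Res p. chi a * cubic_char_sum a) = 0"
proof -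
  have "(\<Sum>a\<in>Res p. chi a * cubic_char_sum a) = (\<Sum>x\<in>Res p. \<Sum>a\<in>Res p. chi (a + 0) * chi (a + x ^ 3))"
    unfolding cubic_char_sum_def sum_distrib_left by (subst sum.swap) simp
  also have "\<dots> = (\<Sum>x\<in>Res p. (if x = 0 then int p else 0) - 1)"
  proof (rule sum.cong)
    fix x assume x: "x \<in> Res p"
    have "[0 = x ^ 3] (mod int p) \<longleftrightarrow> int p dvd x"
      using int_prime by (simp add: cong_sym_eq[of 0] cong_0_iff prime_dvd_power_iff)
    also have "\<dots> \<longleftrightarrow> x = 0" using x by (auto dest: zdvd_imp_le)
    finally show "(\<Sum>a\<in>Res p. chi (a + 0) * chi (a + x ^ 3)) = (if x = 0 then int p else 0) - 1"
      unfolding sum_chi_shift by simp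
  qed simp
  also have "\<dots> = 0" using p0 by (simp add: sum_subtractf)
  finally show ?thesis .
qed

text \<open>
  Expanding the square leaves, for each pair \<open>(x, y)\<close>, a sum of the kind computed in
  \<open>sum_chi_shift\<close>, so the moment counts the pairs with equal cubes.
\<close>
lemma second_moment: "(\<Sum>a\<in>Res p. cubic_char_sum a * cubic_char_sum a) = int p * (2 * int p - 2)"
proof -
  have "(\<Sum>a\<in>Res p. cubic_char_sum a * cubic_char_sum a) = (\<Sum>a\<in>Res p. \<Sum>y\<in>Res p. \<Sum>x\<in>Res p. chi (a + x ^ 3) * chi (a + y ^ 3))"
    unfolding cubic_char_sum_def sum_product by (subst (2) sum.swap) simp
  also have "\<dots> = (\<Sum>y\<in>Res p. \<Sum>x\<in>Res p. \<Sum>a\<in>Res p. chi (a + x ^ 3) * chi (a + y ^ 3))"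
    by (subst sum.swap, rule sum.cong[OF refl], rule sum.swap)
  also have "\<dots> = (\<Sum>y\<in>Res p. \<Sum>x\<in>Res p. (if [x ^ 3 = y ^ 3] (mod int p) then int p else 0) - 1)"
    unfolding sum_chi_shift by (intro sum.cong) auto
  also have "\<dots> = (\<Sum>y\<in>Res p. (if y = 0 then int p else 3 * int p) - int p)"
  proof (rule sum.cong)
    fix y assume y: "y \<in> Res p"
    have "(\<Sum>x\<in>Res p. (if [x ^ 3 = y ^ 3] (mod int p) then int p else 0) - 1)
       = int (card {x \<in> Res p. [x ^ 3 = y ^ 3] (mod int p)}) * int p - int p"
      by (simp add: sum_subtractf sum.If_cases Int_def)
    also have "card {x \<in> Res p. [x ^ 3 = y ^ 3] (mod int p)} = (if y = 0 then 1 else 3)"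
    proof (cases "y = 0")
      case True
      have "{x \<in> Res p. [x ^ 3 = y ^ 3] (mod int p)} = {0}"
        using True int_prime p0 by (auto simp: cong_0_iff prime_dvd_power_iff dest: zdvd_imp_le)
      thus ?thesis using True by simp
    next
      case False
      hence "\<not> int p dvd y" using y by (auto dest: zdvd_imp_le)
      thus ?thesis using False card_cube_roots by simp
    qed
    finally show "(\<Sum>x\<in>Res p. (if [x ^ 3 = y ^ 3] (mod int p) then int p else 0) - 1)
      = (if y = 0 then int p else 3 * int p) - int p" by simp
  qed simp
  also have "\<dots> = (\<Sum>y\<in>Res p. 2 * int p - (if y = 0 then 2 * int p else 0))"
    by (intro sum.cong) auto
  also have "\<dots> = int p * (2 * int p - 2)" using p0 by (simp add: sum_subtractf algebra_simps)
  finally show ?thesis .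
qed

text \<open>
  Modulo \<open>2\<close> the sum counts the \<open>x\<close> with \<open>x^3 \<noteq> -1\<close>, of which there are \<open>p - 3\<close>.
\<close>
lemma cubic_char_sum_1_even: "even (cubic_char_sum 1)"
proof -
  have "cubic_char_sum 1 = (\<Sum>x\<in>Res p. chi (1 + x ^ 3))" by (simp add: cubic_char_sum_def)
  also have "even \<dots> \<longleftrightarrow> even (\<Sum>x\<in>Res p. 1 - (if [x ^ 3 = (-1) ^ 3] (mod int p) then 1 else (0::int)))"
  proof -
    have "even (chi (1 + x ^ 3) - (1 - (if [x ^ 3 = (-1) ^ 3] (mod int p) then 1 else (0::int))))" for x
      using chi_cases[of "1 + x ^ 3"] chi_eq_0_iff[of "1 + x ^ 3"]
      by (auto simp: cong_iff_dvd_diff add.commute)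
    hence "even (\<Sum>x\<in>Res p. chi (1 + x ^ 3) - (1 - (if [x ^ 3 = (-1) ^ 3] (mod int p) then 1 else (0::int))))"
      by (intro dvd_sum) simp
    thus ?thesis by (simp only: sum_subtractf[of "\<lambda>x. chi (1 + x ^ 3)"] even_diff) (auto)
  qed
  also have "(\<Sum>x\<in>Res p. 1 - (if [x ^ 3 = (-1) ^ 3] (mod int p) then 1 else (0::int)))
     = int p - int (card {x \<in> Res p. [x ^ 3 = (-1) ^ 3] (mod int p)})"
    by (simp add: sum_subtractf sum.If_cases Int_def)
  also have "\<dots> = int p - 3" using card_cube_roots[of "-1"] p2 by simp
  finally show ?thesis using p p2 prime_odd_nat[of p] by simp
qed

text \<open>
  Multiplied by \<open>\<chi> a\<close>, the sum for \<open>a\<close> depends only on the class of \<open>a\<close> modulo cubes. So there are three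
  values \<open>T 0\<close>, \<open>T 1\<close>, \<open>T 2\<close>, and the two moments say that \<open>T 0 + T 1 + T 2 = 0\<close> and
  \<open>T 0^2 + T 1^2 + T 2^2 = 6p\<close>. Elimination gives \<open>3 (T 0)^2 + (T 1 - T 2)^2 = 12p\<close>, and the
  evenness of \<open>T 0\<close> makes \<open>T 1 - T 2\<close> divisible by \<open>6\<close>.
\<close>
theorem cubic_char_sum_1_squares:
  obtains B where "int p = (cubic_char_sum 1 div 2)\<^sup>2 + 3 * B\<^sup>2"
proof -
  obtain g :: int where g: "\<And>j. [g ^ j = 1] (mod int p) \<longleftrightarrow> (p - 1) dvd j"
    and sum: "\<And>f :: int \<Rightarrow> int. periodic p f \<Longrightarrow> (\<Sum>a\<in>Res p. f a) = f 0 + (\<Sum>i<p - 1. f (g ^ i))"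
    using primitive_root by blast
  have "\<not> int p dvd g"
  proof
    assume "int p dvd g"
    hence "int p dvd g ^ (p - 1)" using p2 by (intro dvd_trans[OF _ dvd_power]) auto
    moreover have "int p dvd g ^ (p - 1) - 1" using g[of "p - 1"] by (simp add: cong_iff_dvd_diff)
    ultimately have "int p dvd g ^ (p - 1) - (g ^ (p - 1) - 1)" by (rule dvd_diff)
    hence "int p dvd 1" by simp
    thus False using p2 by simp
  qed
  hence gi: "\<not> int p dvd g ^ i" for i using int_prime by (meson prime_dvd_power)
  \<comment> \<open>Multiplying \<open>g^i\<close> by the cube \<open>g^3\<close> does not change \<open>T\<close>.\<close>
  define T where "T i = chi (g ^ i) * cubic_char_sum (g ^ i)" for i
  have T3: "T (i + 3) = T i" for i
  proof -
    have "T (i + 3) = chi (g ^ i) * chi (g ^ 3) * (chi g * cubic_char_sum (g ^ i))"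
      unfolding T_def power_add chi_mult cubic_char_sum_twist[OF \<open>\<not> int p dvd g\<close>] ..
    also have "\<dots> = T i * (chi g * chi g)" by (simp add: T_def chi_cube)
    finally show ?thesis by (simp add: chi_square[OF \<open>\<not> int p dvd g\<close>])
  qed
  have group: "(\<Sum>i<3 * n. f i) = int n * (f 0 + f 1 + f 2)" if "\<And>i. f (i + 3) = f i" for f :: "nat \<Rightarrow> int" and n
  proof (induction n)
    case (Suc n)
    have "f (3 * n + j) = f j" for j
    proof (induction n)
      case (Suc n)
      have "3 * Suc n + j = (3 * n + j) + 3" by simp
      thus ?case using Suc that[of "3 * n + j"] by (simp only:)
    qed simp
    from this[of 0] this[of 1] this[of 2] have "f (3 * n) = f 0" "f (3 * n + 1) = f 1" "f (3 * n + 2) = f 2" by simp_all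
    moreover have eq: "3 * Suc n = Suc (Suc (Suc (3 * n)))" by simp
    ultimately show ?case using Suc unfolding eq sum.lessThan_Suc by (simp add: algebra_simps)
  qed simp
  have pq: "p - 1 = 3 * q" "p - Suc 0 = 3 * q" using q by simp_all
  have per: "periodic p (\<lambda>a. chi a * cubic_char_sum a)" "periodic p (\<lambda>a. cubic_char_sum a * cubic_char_sum a)"
    using cubic_char_sum_periodic chi_periodic by (simp_all add: periodic_def)
  have "q > 0" using q p2 by simp
  have "0 = int q * (T 0 + T 1 + T 2)"
  proof -
    have "0 = (\<Sum>i<3 * q. T i)"
      using sum[OF per(1)] first_moment by (simp add: cubic_char_sum_0 pq T_def)
    also have "\<dots> = int q * (T 0 + T 1 + T 2)" by (rule group) (rule T3)
    finally show ?thesis .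
  qed
  hence T_sum: "T 0 + T 1 + T 2 = 0" using \<open>q > 0\<close> by simp
  have "int p * (2 * int p - 2) = (\<Sum>i<3 * q. cubic_char_sum (g ^ i) * cubic_char_sum (g ^ i))"
    using sum[OF per(2)] second_moment by (simp add: cubic_char_sum_0 pq)
  also have "\<dots> = (\<Sum>i<3 * q. T i * T i)"
  proof (rule sum.cong)
    fix i
    have "T i * T i = (chi (g ^ i) * chi (g ^ i)) * (cubic_char_sum (g ^ i) * cubic_char_sum (g ^ i))" by (simp add: T_def)
    thus "cubic_char_sum (g ^ i) * cubic_char_sum (g ^ i) = T i * T i" by (simp only: chi_square[OF gi] mult_1)
  qed simp
  also have "\<dots> = int q * (T 0 * T 0 + T 1 * T 1 + T 2 * T 2)" by (rule group) (simp add: T3)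
  also have "int p * (2 * int p - 2) = int q * (6 * int p)" using q by simp
  finally have T_sq: "T 0 * T 0 + T 1 * T 1 + T 2 * T 2 = 6 * int p" using \<open>q > 0\<close> by simp
  have T0: "T 0 = cubic_char_sum 1" by (simp add: T_def)
  define A where "A = cubic_char_sum 1 div 2"
  define D where "D = T 1 - T 2"
  have A: "T 0 = 2 * A" using cubic_char_sum_1_even T0 by (simp add: A_def)
  have T2: "T 2 = - 2 * A - T 1" using T_sum A by simp
  have D: "12 * A\<^sup>2 + D\<^sup>2 = 12 * int p"
    using T_sq unfolding D_def T2 A by (simp add: power2_eq_square algebra_simps)
  have "even (D\<^sup>2)" "3 dvd D\<^sup>2"
  proof -
    have "D\<^sup>2 = 12 * (int p - A\<^sup>2)" using D by simp
    thus "even (D\<^sup>2)" "3 dvd D\<^sup>2" by (simp_all add: dvd_mult2)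
  qed
  hence "even D" "3 dvd D" by (auto dest: prime_dvd_power[rotated])
  hence "6 dvd D" by presburger
  then obtain B where "D = 6 * B" by auto
  hence "int p = A\<^sup>2 + 3 * B\<^sup>2" using D by (simp add: power2_eq_square)
  thus thesis using that by (simp add: A_def)
qed

text \<open>
  The only monomial of \<open>(1 + x^3)^h\<close> that contributes to the power sums is \<open>x^(3q) = x^(p - 1)\<close>.
\<close>
lemma cubic_char_sum_1_cong: "[cubic_char_sum 1 = - int ((p - 1) div 2 choose q)] (mod int p)"
proof -
  define h where "h = (p - 1) div 2"
  have h: "2 * h = 3 * q" using p p2 prime_odd_nat[of p] q by (auto simp: h_def elim: oddE)
  have f: "(1 + monom 1 3 :: int poly) ^ h = (\<Sum>k\<le>h. smult (int (h choose k)) (monom 1 (3 * k)))"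
    using binomial_ring[of "monom 1 3" "1 :: int poly" h] by (simp add: monom_power of_nat_poly add.commute)
  have "[cubic_char_sum 1 = (\<Sum>a\<in>Res p. poly ((1 + monom 1 3) ^ h) a)] (mod int p)"
    unfolding cubic_char_sum_def by (intro cong_sum) (simp only: poly_power poly_add poly_1 poly_monom mult_1 h_def chi_euler)
  also have "[(\<Sum>a\<in>Res p. poly ((1 + monom 1 3) ^ h) a) = - coeff ((1 + monom 1 3) ^ h) (p - 1)] (mod int p)"
  proof (rule poly_sum)
    have "degree ((1 + monom 1 3 :: int poly) ^ h) \<le> 3 * h"
      unfolding f by (rule degree_sum_le) (auto intro: order.trans[OF degree_smult_le] order.trans[OF degree_monom_le])
    also have "\<dots> < 2 * (p - 1)" using h q p2 by linarith
    finally show "degree ((1 + monom 1 3 :: int poly) ^ h) < 2 * (p - 1)" .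
  qed
  also have "coeff ((1 + monom 1 3 :: int poly) ^ h) (p - 1) = (\<Sum>k\<in>{q}. int (h choose k))"
    unfolding f coeff_sum
    by (rule sum.mono_neutral_cong_right) (use q h in \<open>auto simp: coeff_monom\<close>)
  finally show ?thesis by (simp add: h_def)
qed

end

text \<open>
  Uniqueness of the representation, by the multiplicativity of the norm form: \<open>p\<close> divides one of
  \<open>x B - y A\<close> and \<open>x B + y A\<close>, whose squares, times \<open>3\<close>, are at most \<open>p^2\<close>; so that number is \<open>0\<close>.
\<close>
lemma square_unique_in_x2_plus_3y2:
  fixes x y A B p :: int
  assumes "prime p" "p = x\<^sup>2 + 3 * y\<^sup>2" "p = A\<^sup>2 + 3 * B\<^sup>2"
  shows "x\<^sup>2 = A\<^sup>2"
proof -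
  have "p > 0" using assms(1) by (rule prime_gt_0_int)
  have "(x * B - y * A) * (x * B + y * A) = x\<^sup>2 * B\<^sup>2 - y\<^sup>2 * A\<^sup>2"
    by (simp add: power2_eq_square algebra_simps)
  also have "x\<^sup>2 = p - 3 * y\<^sup>2" using assms(2) by simp
  also have "A\<^sup>2 = p - 3 * B\<^sup>2" using assms(3) by simp
  also have "(p - 3 * y\<^sup>2) * B\<^sup>2 - y\<^sup>2 * (p - 3 * B\<^sup>2) = p * (B\<^sup>2 - y\<^sup>2)"
    by (simp add: algebra_simps)
  finally have "p dvd (x * B - y * A) * (x * B + y * A)" by simp
  hence "p dvd x * B - y * A \<or> p dvd x * B + y * A"
    using assms(1) by (simp add: prime_dvd_mult_iff)
  hence "x * B - y * A = 0 \<or> x * B + y * A = 0"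
  proof (elim disj_forward)
    have small: "u = 0" if "p dvd u" "p\<^sup>2 = v\<^sup>2 + 3 * u\<^sup>2" for u v
    proof (rule ccontr)
      assume "u \<noteq> 0"
      hence "p \<le> \<bar>u\<bar>" using dvd_imp_le_int[OF _ that(1)] \<open>p > 0\<close> by simp
      hence "p\<^sup>2 \<le> u\<^sup>2" using \<open>p > 0\<close> by (metis abs_le_square_iff abs_of_pos)
      moreover have "v\<^sup>2 \<ge> 0" "u\<^sup>2 > 0" using \<open>u \<noteq> 0\<close> by auto
      ultimately show False using that(2) by linarith
    qed
    have norm_mult: "p\<^sup>2 = (x\<^sup>2 + 3 * y\<^sup>2) * (A\<^sup>2 + 3 * B\<^sup>2)" using assms by (simp add: power2_eq_square)
    show "x * B - y * A = 0" if "p dvd x * B - y * A"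
      by (rule small[OF that, of "x * A + 3 * y * B"]) (unfold norm_mult, simp add: power2_eq_square algebra_simps)
    show "x * B + y * A = 0" if "p dvd x * B + y * A"
      by (rule small[OF that, of "x * A - 3 * y * B"]) (unfold norm_mult, simp add: power2_eq_square algebra_simps)
  qed
  hence "x * B = y * A \<or> x * B = - (y * A)" by auto
  hence "(x * B)\<^sup>2 = (y * A)\<^sup>2" by auto
  hence eq: "x\<^sup>2 * B\<^sup>2 = y\<^sup>2 * A\<^sup>2" by (simp add: power_mult_distrib)
  have "x\<^sup>2 * p = x\<^sup>2 * A\<^sup>2 + 3 * (x\<^sup>2 * B\<^sup>2)" unfolding assms(3) by (simp add: algebra_simps)
  also have "\<dots> = (x\<^sup>2 + 3 * y\<^sup>2) * A\<^sup>2" unfolding eq by (simp add: algebra_simps)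
  also have "\<dots> = A\<^sup>2 * p" using assms(2) by simp
  finally show ?thesis using \<open>p > 0\<close> by simp
qed

section \<open>The congruence for p-integral rationals\<close>

lemma p_integral_divide:
  assumes "prime p" "\<not> int p dvd d"
  shows "(of_int a / of_int d :: rat) \<in> p_integral p"
proof -
  obtain n m where q: "quotient_of (of_int a / of_int d) = (n, m)" by (cases "quotient_of (of_int a / of_int d :: rat)")
  have d: "d \<noteq> 0" using assms(2) by auto
  have eq: "of_int a / of_int d = (of_int n / of_int m :: rat)" using quotient_of_div[OF q] .
  have m: "m > 0" "coprime n m" using quotient_of_denom_pos[OF q] quotient_of_coprime[OF q] .
  have "(of_int (a * m) :: rat) = of_int (n * d)" using eq d m by (simp add: field_simps)
  hence "a * m = n * d" by (simp only: of_int_eq_iff)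
  hence "m dvd n * d" by (metis dvd_triv_right)
  hence "m dvd d" using m(2) by (metis coprime_commute coprime_dvd_mult_right_iff)
  thus ?thesis using assms(2) dvd_trans q by (auto simp: p_integral_def)
qed

lemma p_cong_divide:
  assumes "prime p" "\<not> int p dvd d" "[a = b * d] (mod int p)"
  shows "p_cong p (of_int a / of_int d) (of_int b)"
proof -
  obtain k where k: "a - b * d = int p * k" using assms(3) by (auto simp: cong_iff_dvd_diff)
  have d: "d \<noteq> 0" using assms(2) by auto
  have "\<not> int p dvd 1" using assms(1) by (auto dest: not_prime_unit)
  hence "(of_int b / of_int 1 :: rat) \<in> p_integral p" using assms(1) by (intro p_integral_divide)
  moreover have "of_int a / of_int d - of_int b = of_nat p * (of_int k / of_int d :: rat)"
  proof -
    have "(of_int a - of_int b * of_int d :: rat) = of_nat p * of_int k"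
      using arg_cong[OF k, of "of_int :: int \<Rightarrow> rat"] by simp
    thus ?thesis using d by (simp add: field_simps)
  qed
  ultimately show ?thesis
    unfolding p_cong_def using p_integral_divide[OF assms(1,2)]
    by (auto intro!: bexI[of _ "of_int k / of_int d"])
qed

text \<open>
  The quotient \<open>coeff ([:-1, 0, 1:]^m) m / 2^m\<close> is the value at \<open>0\<close> of the Legendre
  polynomial, and the sum is congruent to its square. Denominators are cleared by \<open>50^(p - 1)\<close>, which is \<open>1\<close> modulo \<open>p\<close>.
\<close>
lemma franel_sum_p_cong:
  assumes p: "prime p" "p > 5" and m: "p = 3 * m + 1 \<or> p = 3 * m + 2"
    and c: "[coeff ([:-1, 0, 1:] ^ m) m = 2 ^ m * b] (mod int p)"
  shows "p_cong p (\<Sum>k = 0..p - 1. of_nat ((2 * k) choose k) * (of_nat (franel k) / 50 ^ k)) (of_int (b\<^sup>2))"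
proof -
  define S where "S = (\<Sum>k | 2 * k < p. central_franel k * 50 ^ (p - 1 - k))"
  define L where "L = (\<Sum>k | 3 * k < p. multinom3 k * 54 ^ (p - 1 - k))"
  define S' where "S' = (\<Sum>k<p. central_franel k * 50 ^ (p - 1 - k))"
  have nd: "\<not> p dvd 50" "\<not> int p dvd 2"
  proof -
    have q: "\<not> p dvd 2" "\<not> p dvd 5" using p by (auto dest!: dvd_imp_le)
    hence "\<not> p dvd 2 * (5 * 5)" using p(1) by (simp only: prime_dvd_mult_iff simp_thms)
    thus "\<not> p dvd 50" by simp
    show "\<not> int p dvd 2" using p by (auto dest!: zdvd_imp_le)
  qed
  have "coprime (2 ^ m) (int p)"
    using p nd(2) by (metis coprime_commute coprime_power_left_iff prime_imp_coprime prime_nat_int_transfer)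
  moreover have "[2 ^ m * L = 2 ^ m * b] (mod int p)"
    using multinom3_sum_cong[OF p m, folded L_def] c by (rule cong_trans)
  ultimately have "[L = b] (mod int p)" by (simp only: cong_mult_lcancel)
  hence "[L\<^sup>2 = b\<^sup>2] (mod int p)" by (rule cong_pow)
  with central_franel_sum_cong_square[OF p, folded S_def L_def] have S: "[S = b\<^sup>2] (mod int p)"
    by (rule cong_trans)
  have "[S' = (\<Sum>k<p. if 2 * k < p then central_franel k * 50 ^ (p - 1 - k) else 0)] (mod int p)"
    unfolding S'_def
  proof (rule cong_sum)
    fix k assume "k \<in> {..<p}"
    thus "[central_franel k * 50 ^ (p - 1 - k) = (if 2 * k < p then central_franel k * 50 ^ (p - 1 - k) else 0)] (mod int p)"
      using prime_dvd_central_franel[OF p(1), of k] by (auto simp: cong_0_iff)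
  qed
  also have "(\<Sum>k<p. if 2 * k < p then central_franel k * 50 ^ (p - 1 - k) else 0) = S"
    unfolding S_def by (rule sum.mono_neutral_cong_right) auto
  also have "[S = b\<^sup>2 * 50 ^ (p - 1)] (mod int p)"
  proof -
    have "[b\<^sup>2 * 50 ^ (p - 1) = b\<^sup>2] (mod int p)"
      using fermat_cong_mult[OF p(1) nd(1), of "b\<^sup>2"] by (simp only: of_nat_numeral mult.commute)
    thus ?thesis using S by (meson cong_sym cong_trans)
  qed
  finally have S': "[S' = b\<^sup>2 * 50 ^ (p - 1)] (mod int p)" .
  have nd': "\<not> int p dvd 50 ^ (p - 1)"
  proof
    assume "int p dvd 50 ^ (p - 1)"
    hence "int p dvd int 50" using p(1) prime_dvd_power[of "int p" 50] by simp
    thus False using nd(1) by (simp only: int_dvd_int_iff)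
  qed
  have "(\<Sum>k = 0..p - 1. of_nat ((2 * k) choose k) * (of_nat (franel k) / 50 ^ k)) = (\<Sum>k<p. of_nat ((2 * k) choose k) * (of_nat (franel k) / 50 ^ k) :: rat)"
    using p by (intro sum.cong) auto
  also have "\<dots> = (\<Sum>k<p. of_int (central_franel k * 50 ^ (p - 1 - k)) / of_int (50 ^ (p - 1)))"
  proof (rule sum.cong)
    fix k assume "k \<in> {..<p}"
    hence "(50 :: rat) ^ (p - 1) = 50 ^ k * 50 ^ (p - 1 - k)" by (simp flip: power_add)
    thus "of_nat ((2 * k) choose k) * (of_nat (franel k) / 50 ^ k) = (of_int (central_franel k * 50 ^ (p - 1 - k)) / of_int (50 ^ (p - 1)) :: rat)"
      by (simp add: central_franel_def)
  qed simp
  also have "\<dots> = of_int S' / of_int (50 ^ (p - 1))" by (simp add: S'_def sum_divide_distrib)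
  finally show ?thesis using p_cong_divide[OF p(1) nd' S'] by simp
qed

theorem theorem2p2:
  fixes p :: nat
  assumes "prime p" and "p > 5"
  shows "([p = 1] (mod 3) \<longrightarrow>
           (\<exists>x y :: int. int p = x\<^sup>2 + 3 * y\<^sup>2) \<and>
           (\<forall>x y :: int. int p = x\<^sup>2 + 3 * y\<^sup>2 \<longrightarrow>
              p_cong p (\<Sum>k = 0..p - 1. of_nat ((2 * k) choose k) * (of_nat (franel k) / 50 ^ k))
                       (of_int (4 * x\<^sup>2))))
       \<and> ([p = 2] (mod 3) \<longrightarrow>
           p_cong p (\<Sum>k = 0..p - 1. of_nat ((2 * k) choose k) * (of_nat (franel k) / 50 ^ k)) 0)"
proof (intro conjI impI)
  have odd: "odd p" using assms prime_odd_nat by auto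
  {
    assume "[p = 1] (mod 3)"
    hence "p mod 3 = 1" by (simp add: cong_def)
    then obtain q where q: "p = 3 * q + 1" by (metis mult_div_mod_eq)
    obtain n where n: "q = 2 * n" using odd q by auto
    interpret prime_1_mod_3 p q using assms q by unfold_locales auto
    obtain B where B: "int p = (cubic_char_sum 1 div 2)\<^sup>2 + 3 * B\<^sup>2" by (rule cubic_char_sum_1_squares)
    show "\<exists>x y :: int. int p = x\<^sup>2 + 3 * y\<^sup>2" using B by blast
    show "\<forall>x y :: int. int p = x\<^sup>2 + 3 * y\<^sup>2 \<longrightarrow>
              p_cong p (\<Sum>k = 0..p - 1. of_nat ((2 * k) choose k) * (of_nat (franel k) / 50 ^ k))
                       (of_int (4 * x\<^sup>2))"
    proof (intro allI impI)
      fix x y :: int assume xy: "int p = x\<^sup>2 + 3 * y\<^sup>2"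
      have "x\<^sup>2 = (cubic_char_sum 1 div 2)\<^sup>2"
        using square_unique_in_x2_plus_3y2[OF int_prime xy B] .
      hence x: "4 * x\<^sup>2 = (- cubic_char_sum 1)\<^sup>2" using cubic_char_sum_1_even by (auto elim!: evenE simp: power_mult_distrib)
      define h where "h = 3 * n"
      have h: "p = 2 * h + 1" "(p - 1) div 2 = h" using q n by (simp_all add: h_def)
      have sym: "h choose q = h choose n" using binomial_symmetric[of n h] by (simp add: h_def n)
      have "coeff ([:-1, 0, 1:] ^ q) q = (-1) ^ n * int (2 * n choose n)"
        by (simp add: coeff_x2_minus_1_power n)
      also have "[\<dots> = (-1) ^ n * ((-4) ^ n * int (h choose n))] (mod int p)"
        using half_binomial_cong[OF p h(1), of n] h by (intro cong_scalar_left) (simp add: h_def cong_sym_eq)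
      also have "(-1) ^ n * ((-4) ^ n * int (h choose n)) = 2 ^ q * int (h choose n)"
        by (simp add: n power_mult flip: power_mult_distrib mult.assoc)
      also have "[2 ^ q * int (h choose n) = 2 ^ q * (- cubic_char_sum 1)] (mod int p)"
      proof (rule cong_scalar_left)
        have "int p dvd cubic_char_sum 1 - - int (h choose n)"
          using cubic_char_sum_1_cong unfolding h(2) sym by (simp only: cong_iff_dvd_diff)
        thus "[int (h choose n) = - cubic_char_sum 1] (mod int p)" by (simp add: cong_iff_dvd_diff add.commute)
      qed
      finally have "[coeff ([:-1, 0, 1:] ^ q) q = 2 ^ q * (- cubic_char_sum 1)] (mod int p)" .
      thus "p_cong p (\<Sum>k = 0..p - 1. of_nat ((2 * k) choose k) * (of_nat (franel k) / 50 ^ k)) (of_int (4 * x\<^sup>2))"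
        unfolding x using assms q by (intro franel_sum_p_cong[of p q]) auto
    qed
  next
    assume "[p = 2] (mod 3)"
    hence "p mod 3 = 2" by (simp add: cong_def)
    then obtain m where m: "p = 3 * m + 2" by (metis mult_div_mod_eq)
    have "odd m" using odd m by auto
    hence "[coeff ([:-1, 0, 1:] ^ m) m = 2 ^ m * 0] (mod int p)"
      by (simp add: coeff_x2_minus_1_power)
    from franel_sum_p_cong[OF assms disjI2[OF m] this]
    show "p_cong p (\<Sum>k = 0..p - 1. of_nat ((2 * k) choose k) * (of_nat (franel k) / 50 ^ k)) 0" by simp
  }
qed

end
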